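(* For each $0<a<\infty$, the integral operator $\mathsf{G}_g[a]:L^2(-a,a)\to L^2(-a,a)$, $\phi(t)\mapsto\mathbf{1}_{[-a,a]}(t)\int_{-a}^aG_g(t,u)\phi(u)\,du$, is a trace class operator (unconditionally, i.e. without assuming the Riemann hypothesis).
   Context: $\Lambda$ is the von Mangoldt function, $G$ is Catalan's constant, $C=\pi^2+8G$, $\Phi(z,s,a)=\sum_{n\ge0}(n+a)^{-s}z^n$. For $t\ge0$, \[\Psi(t):=4(e^{t/2}+e^{-t/2}-2)-\sum_{n\le e^t}\frac{\Lambda(n)}{\sqrt n}(t-\log n)+\frac t2\Big[\frac{\Gamma'}{\Gamma}\Big(\frac14\Big)-\log\pi\Big]+\frac14\Big(C-e^{-t/2}\Phi(e^{-2t},2,1/4)\Big),\] extended evenly to $\mathbb{R}$. Let $g=-\Psi$ and $G_g(t,u)=g(t-u)-g(t)-g(-u)+g(0)$. $\mathbf{1}_A$ is the indicator function of $A$. *)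

theory Defs
  imports "HOL-Analysis.Analysis" "HOL-Number_Theory.Number_Theory"
begin

section \<open>Operators on complex \<open>L\<^sup>2\<close> spaces\<close>

text \<open>
  Elements of \<open>L\<^sup>2(M)\<close> are represented by square integrable functions; equality of
  classes is equality almost everywhere. An operator is a map on representatives that respects
  this equality; its values outside \<open>L2 M\<close> are irrelevant.
\<close>

definition L2 :: "'a measure \<Rightarrow> ('a \<Rightarrow> complex) set" where
  "L2 M = {f \<in> borel_measurable M. integrable M (\<lambda>x. (cmod (f x))\<^sup>2)}"

definition L2_eq :: "'a measure \<Rightarrow> ('a \<Rightarrow> complex) \<Rightarrow> ('a \<Rightarrow> complex) \<Rightarrow> bool" where
  "L2_eq M f g \<longleftrightarrow> (AE x in M. f x = g x)"

definition L2_inner :: "'a measure \<Rightarrow> ('a \<Rightarrow> complex) \<Rightarrow> ('a \<Rightarrow> complex) \<Rightarrow> complex" where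
  "L2_inner M f g = (LINT x|M. f x * cnj (g x))"

definition L2_norm :: "'a measure \<Rightarrow> ('a \<Rightarrow> complex) \<Rightarrow> real" where
  "L2_norm M f = sqrt (LINT x|M. (cmod (f x))\<^sup>2)"

definition L2_bounded_linear ::
    "'a measure \<Rightarrow> (('a \<Rightarrow> complex) \<Rightarrow> ('a \<Rightarrow> complex)) \<Rightarrow> bool" where
  "L2_bounded_linear M T \<longleftrightarrow>
     (\<forall>f \<in> L2 M. T f \<in> L2 M) \<and>
     (\<forall>f \<in> L2 M. \<forall>g \<in> L2 M. L2_eq M f g \<longrightarrow> L2_eq M (T f) (T g)) \<and>
     (\<forall>f \<in> L2 M. \<forall>g \<in> L2 M. L2_eq M (T (\<lambda>x. f x + g x)) (\<lambda>x. T f x + T g x)) \<and>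
     (\<forall>c. \<forall>f \<in> L2 M. L2_eq M (T (\<lambda>x. c * f x)) (\<lambda>x. c * T f x)) \<and>
     (\<exists>K. \<forall>f \<in> L2 M. L2_norm M (T f) \<le> K * L2_norm M f)"

definition L2_positive ::
    "'a measure \<Rightarrow> (('a \<Rightarrow> complex) \<Rightarrow> ('a \<Rightarrow> complex)) \<Rightarrow> bool" where
  "L2_positive M P \<longleftrightarrow>
     L2_bounded_linear M P \<and> (\<forall>f \<in> L2 M. L2_inner M (P f) f \<in> \<real>\<^sub>\<ge>\<^sub>0)"

definition L2_adjoint ::
    "'a measure \<Rightarrow> (('a \<Rightarrow> complex) \<Rightarrow> ('a \<Rightarrow> complex)) \<Rightarrow>
     (('a \<Rightarrow> complex) \<Rightarrow> ('a \<Rightarrow> complex)) \<Rightarrow> bool" where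
  "L2_adjoint M T S \<longleftrightarrow>
     L2_bounded_linear M S \<and>
     (\<forall>f \<in> L2 M. \<forall>g \<in> L2 M. L2_inner M (T f) g = L2_inner M f (S g))"

text \<open>
  \<open>L2_abs M T P\<close>: \<open>P\<close> is the absolute value \<open>|T| = (T\<^sup>* T)\<^sup>1\<^sup>/\<^sup>2\<close>, that is, the positive
  operator with square \<open>T\<^sup>* T\<close>, which is unique up to equality almost everywhere.
\<close>

definition L2_abs ::
    "'a measure \<Rightarrow> (('a \<Rightarrow> complex) \<Rightarrow> ('a \<Rightarrow> complex)) \<Rightarrow>
     (('a \<Rightarrow> complex) \<Rightarrow> ('a \<Rightarrow> complex)) \<Rightarrow> bool" where
  "L2_abs M T P \<longleftrightarrow>
     L2_positive M P \<and>
     (\<exists>S. L2_adjoint M T S \<and> (\<forall>f \<in> L2 M. L2_eq M (P (P f)) (S (T f))))"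

text \<open>An orthonormal basis is a maximal orthonormal set.\<close>

definition L2_orthonormal_basis :: "'a measure \<Rightarrow> ('a \<Rightarrow> complex) set \<Rightarrow> bool" where
  "L2_orthonormal_basis M E \<longleftrightarrow>
     E \<subseteq> L2 M \<and>
     (\<forall>e \<in> E. \<forall>e' \<in> E. L2_inner M e e' = (if e = e' then 1 else 0)) \<and>
     (\<forall>f \<in> L2 M. (\<forall>e \<in> E. L2_inner M f e = 0) \<longrightarrow> L2_eq M f (\<lambda>_. 0))"

text \<open>
  \<open>T\<close> is of trace class if the trace \<open>\<Sum>e. \<langle>|T| e, e\<rangle>\<close> is finite. The terms are
  nonnegative and the value of the sum does not depend on the orthonormal basis.
\<close>

definition L2_trace_class ::
    "'a measure \<Rightarrow> (('a \<Rightarrow> complex) \<Rightarrow> ('a \<Rightarrow> complex)) \<Rightarrow> bool" where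
  "L2_trace_class M T \<longleftrightarrow>
     L2_bounded_linear M T \<and>
     (\<exists>P E. L2_abs M T P \<and> L2_orthonormal_basis M E \<and>
            (\<lambda>e. L2_inner M (P e) e) summable_on E)"


section \<open>The function \<open>\<Psi>\<close> and the kernel\<close>

definition catalan :: real where
  "catalan = (\<Sum>n. (-1) ^ n / (2 * real n + 1)\<^sup>2)"

text \<open>The Lerch transcendent, for real arguments with \<open>a > 0\<close>.\<close>

definition lerch_Phi :: "real \<Rightarrow> real \<Rightarrow> real \<Rightarrow> real" where
  "lerch_Phi z s a = (\<Sum>n. (real n + a) powr (- s) * z ^ n)"

definition Psi_nonneg :: "real \<Rightarrow> real" where
  "Psi_nonneg t =
     4 * (exp (t / 2) + exp (- t / 2) - 2)
     - (\<Sum>n | 1 \<le> n \<and> real n \<le> exp t. mangoldt n / sqrt (real n) * (t - ln (real n)))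
     + t / 2 * (Digamma (1 / 4) - ln pi)
     + 1 / 4 * ((pi\<^sup>2 + 8 * catalan) - exp (- t / 2) * lerch_Phi (exp (- 2 * t)) 2 (1 / 4))"

definition Psi :: "real \<Rightarrow> real" where
  "Psi t = Psi_nonneg \<bar>t\<bar>"

definition screw_kernel :: "(real \<Rightarrow> real) \<Rightarrow> real \<Rightarrow> real \<Rightarrow> real" where
  "screw_kernel g t u = g (t - u) - g t - g (- u) + g 0"

definition screw_operator ::
    "(real \<Rightarrow> real) \<Rightarrow> real \<Rightarrow> (real \<Rightarrow> complex) \<Rightarrow> (real \<Rightarrow> complex)" where
  "screw_operator g a \<phi> =
     (\<lambda>t. indicator {-a..a} t *
            (LBINT u:{-a..a}. complex_of_real (screw_kernel g t u) * \<phi> u))"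

end

(*
  The integral operator T is self-adjoint and compact, so it has an orthonormal eigenbasis, and
  |T| is the series of the sgn(l) <f, e> T e over the eigenpairs (l, e). This series converges
  absolutely at every point, by Cauchy-Schwarz and Bessel, because (T e)(t) is the inner product of
  e with a row of the kernel; no completeness of L^2 is needed. The trace of |T| is the sum of the
  |<T e, e>| over the eigenbasis. Such sums over orthonormal families are bounded for the product
  of two Hilbert-Schmidt operators, and every term of the kernel has this shape: for x = t - u, the
  function Psi is a combination of exp(x/2), exp(-x/2), finitely many |x - l|, and the series of
  the (n + 1/4)^(-2) exp(-(2n + 1/2) |x|), where

    max(0, u + l - t) = int 1[t <= y] 1[y <= u + l] dy,
    exp(-c |t - u|) = exp(-c (t + a)) exp(-c (u + a))
        + int_{-a}^{a} 1[y <= t] 1[y <= u] 2c exp(-c (t - y)) exp(-c (u - y)) dy.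

  The trace norm of the kernel exp(-c |t - u|) is bounded uniformly in c, so the coefficients
  (n + 1/4)^(-2) are summable against it.
*)
theory Submission
  imports Defs "HOL-Complex_Analysis.Great_Picard"
begin

section \<open>Square integrable functions\<close>

text \<open>The definition through |T| is awkward for sums: |A + B| is not dominated by |A| + |B| as
  an operator, and pieces such as |t - u - l| are not even symmetric. Sums of |<T e, e>| over finite
  orthonormal sets, in contrast, are subadditive in the kernel for trivial reasons. The pieces are
  therefore estimated in this form, and only the full symmetric kernel meets the spectral theorem.
  The eigenbasis is obtained from Zorn's lemma and might a priori be uncountable; the uniform bound
  itself shows that only countably many eigenvalues are nonzero, which is what permits a series for
  |T|.\<close>

lemma borel_measurable_cnj [measurable (raw)]:
  "f \<in> borel_measurable M \<Longrightarrow> (\<lambda>x. cnj (f x)) \<in> borel_measurable M"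
  by (rule borel_measurable_continuous_on[where f = cnj]) (intro continuous_intros)

lemma L2I:
  assumes "f \<in> borel_measurable M" "integrable M (\<lambda>x. (cmod (f x))\<^sup>2)"
  shows "f \<in> L2 M"
  using assms by (simp add: L2_def)

lemma L2_measurable [measurable_dest]: "f \<in> L2 M \<Longrightarrow> f \<in> borel_measurable M"
  by (simp add: L2_def)

lemma L2_integrable_square: "f \<in> L2 M \<Longrightarrow> integrable M (\<lambda>x. (cmod (f x))\<^sup>2)"
  by (simp add: L2_def)

lemma norm_mult_le_sum_squares: "cmod (x * y) \<le> (cmod x)\<^sup>2 + (cmod y)\<^sup>2"
proof -
  have "2 * (cmod x * cmod y) \<le> (cmod x)\<^sup>2 + (cmod y)\<^sup>2"
    using sum_squares_bound[of "cmod x" "cmod y"] by simp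
  moreover have "0 \<le> cmod x * cmod y" by simp
  ultimately show ?thesis unfolding norm_mult by linarith
qed

lemma L2_mult_integrable:
  assumes "f \<in> L2 M" "g \<in> L2 M"
  shows "integrable M (\<lambda>x. f x * g x)"
proof (rule Bochner_Integration.integrable_bound)
  show "integrable M (\<lambda>x. (cmod (f x))\<^sup>2 + (cmod (g x))\<^sup>2)"
    using assms by (simp add: L2_integrable_square)
  show "(\<lambda>x. f x * g x) \<in> borel_measurable M"
    using assms by (auto simp: L2_def)
  show "AE x in M. norm (f x * g x) \<le> norm ((cmod (f x))\<^sup>2 + (cmod (g x))\<^sup>2)"
    using norm_mult_le_sum_squares by (intro AE_I2) (simp del: norm_mult add: order_trans[OF _ abs_ge_self])
qed

lemma L2_cnj: "f \<in> L2 M \<Longrightarrow> (\<lambda>x. cnj (f x)) \<in> L2 M"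
  by (auto simp: L2_def)

lemma L2_inner_integrable:
  "f \<in> L2 M \<Longrightarrow> g \<in> L2 M \<Longrightarrow> integrable M (\<lambda>x. f x * cnj (g x))"
  using L2_mult_integrable[OF _ L2_cnj] by blast

lemma L2_zero: "(\<lambda>_. 0) \<in> L2 M"
  by (simp add: L2_def)

lemma L2_scale: "f \<in> L2 M \<Longrightarrow> (\<lambda>x. c * f x) \<in> L2 M"
  by (auto simp: L2_def norm_mult power_mult_distrib)

lemma L2_add:
  assumes "f \<in> L2 M" "g \<in> L2 M"
  shows "(\<lambda>x. f x + g x) \<in> L2 M"
proof (rule L2I)
  have [measurable]: "f \<in> borel_measurable M" "g \<in> borel_measurable M"
    using assms by (auto simp: L2_def)
  show "(\<lambda>x. f x + g x) \<in> borel_measurable M" by simp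
  show "integrable M (\<lambda>x. (cmod (f x + g x))\<^sup>2)"
  proof (rule Bochner_Integration.integrable_bound)
    show "integrable M (\<lambda>x. 2 * ((cmod (f x))\<^sup>2 + (cmod (g x))\<^sup>2))"
      using assms by (simp add: L2_integrable_square)
    have "(cmod (f x + g x))\<^sup>2 \<le> 2 * ((cmod (f x))\<^sup>2 + (cmod (g x))\<^sup>2)" for x
    proof -
      have "(cmod (f x + g x))\<^sup>2 \<le> (cmod (f x) + cmod (g x))\<^sup>2"
        by (intro power_mono norm_triangle_ineq) simp
      also have "\<dots> \<le> 2 * ((cmod (f x))\<^sup>2 + (cmod (g x))\<^sup>2)"
        using sum_squares_bound[of "cmod (f x)" "cmod (g x)"] by (simp add: power2_sum)
      finally show ?thesis .
    qed
    then show "AE x in M. norm ((cmod (f x + g x))\<^sup>2) \<le> norm (2 * ((cmod (f x))\<^sup>2 + (cmod (g x))\<^sup>2))"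
      by simp
  qed simp
qed

lemma L2_diff:
  assumes "f \<in> L2 M" "g \<in> L2 M"
  shows "(\<lambda>x. f x - g x) \<in> L2 M"
  using L2_add[OF assms(1) L2_scale[OF assms(2), of "-1"]] by simp

lemma L2_sum: "(\<And>i. i \<in> I \<Longrightarrow> f i \<in> L2 M) \<Longrightarrow> (\<lambda>x. \<Sum>i\<in>I. f i x) \<in> L2 M"
  by (induction I rule: infinite_finite_induct) (auto simp: L2_zero L2_add)

section \<open>Algebra of the inner product and the norm\<close>

lemma L2_inner_commute: "L2_inner M g f = cnj (L2_inner M f g)"
proof -
  have "cnj (L2_inner M f g) = (LINT x|M. cnj (f x * cnj (g x)))"
    unfolding L2_inner_def by (rule Bochner_Integration.integral_cnj[symmetric])
  then show ?thesis
    unfolding L2_inner_def by (simp add: mult.commute)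
qed

lemma L2_inner_zero_left [simp]: "L2_inner M (\<lambda>_. 0) g = 0"
  and L2_inner_zero_right [simp]: "L2_inner M g (\<lambda>_. 0) = 0"
  by (simp_all add: L2_inner_def)

lemma L2_inner_scale_left: "L2_inner M (\<lambda>x. c * f x) g = c * L2_inner M f g"
  by (simp add: L2_inner_def mult.assoc)

lemma L2_inner_scale_right: "L2_inner M g (\<lambda>x. c * f x) = cnj c * L2_inner M g f"
  by (metis L2_inner_commute L2_inner_scale_left complex_cnj_mult)

lemma L2_inner_add_left:
  assumes "f \<in> L2 M" "g \<in> L2 M" "h \<in> L2 M"
  shows "L2_inner M (\<lambda>x. f x + g x) h = L2_inner M f h + L2_inner M g h"
  unfolding L2_inner_def distrib_right
  by (intro Bochner_Integration.integral_add L2_inner_integrable assms)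

lemma L2_inner_diff_left:
  assumes "f \<in> L2 M" "g \<in> L2 M" "h \<in> L2 M"
  shows "L2_inner M (\<lambda>x. f x - g x) h = L2_inner M f h - L2_inner M g h"
  unfolding L2_inner_def left_diff_distrib
  by (intro Bochner_Integration.integral_diff L2_inner_integrable assms)

lemma L2_inner_add_right:
  assumes "f \<in> L2 M" "g \<in> L2 M" "h \<in> L2 M"
  shows "L2_inner M h (\<lambda>x. f x + g x) = L2_inner M h f + L2_inner M h g"
  using L2_inner_add_left[OF assms] by (metis L2_inner_commute complex_cnj_add)

lemma L2_inner_diff_right:
  assumes "f \<in> L2 M" "g \<in> L2 M" "h \<in> L2 M"
  shows "L2_inner M h (\<lambda>x. f x - g x) = L2_inner M h f - L2_inner M h g"
  using L2_inner_diff_left[OF assms] by (metis L2_inner_commute complex_cnj_diff)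

lemma L2_inner_sum_left:
  assumes "\<And>i. i \<in> I \<Longrightarrow> f i \<in> L2 M" "h \<in> L2 M"
  shows "L2_inner M (\<lambda>x. \<Sum>i\<in>I. f i x) h = (\<Sum>i\<in>I. L2_inner M (f i) h)"
  unfolding L2_inner_def sum_distrib_right
  by (intro Bochner_Integration.integral_sum L2_inner_integrable assms)

lemma L2_eq_sym: "L2_eq M f g \<Longrightarrow> L2_eq M g f"
  unfolding L2_eq_def by (auto elim: AE_mp)

lemma L2_eqI: "(\<And>x. x \<in> space M \<Longrightarrow> f x = g x) \<Longrightarrow> L2_eq M f g"
  by (simp add: L2_eq_def)

lemma L2_inner_cong_left:
  assumes "L2_eq M f f'" "f \<in> L2 M" "f' \<in> L2 M" "g \<in> L2 M"
  shows "L2_inner M f g = L2_inner M f' g"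
  unfolding L2_inner_def
proof (rule integral_cong_AE)
  show "AE x in M. f x * cnj (g x) = f' x * cnj (g x)"
    using assms(1) unfolding L2_eq_def by eventually_elim simp
qed (use assms in \<open>auto simp: L2_def\<close>)

lemma L2_norm_nonneg [simp]: "0 \<le> L2_norm M f"
  by (simp add: L2_norm_def)

lemma L2_norm_square: "(L2_norm M f)\<^sup>2 = (LINT x|M. (cmod (f x))\<^sup>2)"
  by (simp add: L2_norm_def)

lemma L2_inner_self: "L2_inner M f f = of_real ((L2_norm M f)\<^sup>2)"
proof -
  have "L2_inner M f f = (LINT x|M. complex_of_real ((cmod (f x))\<^sup>2))"
    unfolding L2_inner_def complex_norm_square ..
  then show ?thesis
    unfolding L2_norm_square by (simp del: of_real_power)
qed

lemma L2_norm_cong: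
  assumes "L2_eq M f g" "f \<in> L2 M" "g \<in> L2 M"
  shows "L2_norm M f = L2_norm M g"
proof -
  have "(LINT x|M. (cmod (f x))\<^sup>2) = (LINT x|M. (cmod (g x))\<^sup>2)"
  proof (rule integral_cong_AE)
    show "AE x in M. (cmod (f x))\<^sup>2 = (cmod (g x))\<^sup>2"
      using assms(1) unfolding L2_eq_def by eventually_elim simp
  qed (use assms in \<open>auto simp: L2_def\<close>)
  then show ?thesis by (simp add: L2_norm_def)
qed

lemma L2_norm_scale: "L2_norm M (\<lambda>x. c * f x) = cmod c * L2_norm M f"
  by (simp add: L2_norm_def norm_mult power_mult_distrib real_sqrt_mult)

lemma L2_norm_eq_0_iff:
  assumes "f \<in> L2 M"
  shows "L2_norm M f = 0 \<longleftrightarrow> L2_eq M f (\<lambda>_. 0)"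
proof -
  have "L2_norm M f = 0 \<longleftrightarrow> (LINT x|M. (cmod (f x))\<^sup>2) = 0"
    by (simp add: L2_norm_def)
  also have "\<dots> \<longleftrightarrow> (AE x in M. (cmod (f x))\<^sup>2 = 0)"
    by (rule integral_nonneg_eq_0_iff_AE) (use assms in \<open>auto simp: L2_def\<close>)
  finally show ?thesis by (simp add: L2_eq_def)
qed

lemma L2_eq_iff_norm_diff:
  assumes "f \<in> L2 M" "g \<in> L2 M"
  shows "L2_eq M f g \<longleftrightarrow> L2_norm M (\<lambda>x. f x - g x) = 0"
  using L2_norm_eq_0_iff[OF L2_diff[OF assms]] by (simp add: L2_eq_def)

section \<open>Orthonormal sets, Bessel and Cauchy-Schwarz inequalities, norm convergence\<close>

definition L2_orthonormal :: "'a measure \<Rightarrow> ('a \<Rightarrow> complex) set \<Rightarrow> bool" where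
  "L2_orthonormal M E \<longleftrightarrow>
     E \<subseteq> L2 M \<and> (\<forall>e\<in>E. \<forall>e'\<in>E. L2_inner M e e' = (if e = e' then 1 else 0))"

lemma L2_orthonormal_mono: "L2_orthonormal M E \<Longrightarrow> F \<subseteq> E \<Longrightarrow> L2_orthonormal M F"
  unfolding L2_orthonormal_def by blast

lemma L2_orthonormal_norm:
  assumes "L2_orthonormal M E" "e \<in> E"
  shows "L2_norm M e = 1"
proof -
  have "complex_of_real ((L2_norm M e)\<^sup>2) = 1"
    using assms L2_inner_self[of M e] by (simp add: L2_orthonormal_def)
  then have "(L2_norm M e)\<^sup>2 = 1" by (metis of_real_eq_1_iff)
  then show ?thesis by (simp add: power2_eq_1_iff) (use L2_norm_nonneg[of M e] in linarith)
qed

text \<open>The projection \<open>s\<close> of \<open>f\<close> onto the span of \<open>F\<close>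
  satisfies <s, f> = <f, s> = <s, s> = \<open>S\<close>, hence the squared norm of f - s equals that
  of f minus \<open>S\<close>, and it is nonnegative.\<close>

lemma L2_bessel:
  assumes "L2_orthonormal M F" "finite F" and f: "f \<in> L2 M"
  shows "(\<Sum>e\<in>F. (cmod (L2_inner M f e))\<^sup>2) \<le> (L2_norm M f)\<^sup>2"
proof -
  define c where "c e = L2_inner M f e" for e
  define s where "s = (\<lambda>x. \<Sum>e\<in>F. c e * e x)"
  have F: "e \<in> L2 M" if "e \<in> F" for e
    using assms that by (auto simp: L2_orthonormal_def)
  have s: "s \<in> L2 M"
    unfolding s_def by (intro L2_sum L2_scale F)
  have inner_s: "L2_inner M s h = (\<Sum>e\<in>F. c e * L2_inner M e h)" if "h \<in> L2 M" for h
    unfolding s_def using that F by (subst L2_inner_sum_left) (auto intro!: L2_scale simp: L2_inner_scale_left)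
  have se: "L2_inner M s e = c e" if "e \<in> F" for e
  proof -
    have "L2_inner M s e = (\<Sum>e'\<in>F. if e = e' then c e' else 0)"
      unfolding inner_s[OF F[OF that]]
      by (intro sum.cong) (use assms that in \<open>auto simp: L2_orthonormal_def\<close>)
    then show ?thesis using assms that by simp
  qed
  define S where "S = (\<Sum>e\<in>F. (cmod (c e))\<^sup>2)"
  have cS: "(\<Sum>e\<in>F. c e * cnj (c e)) = of_real S"
    unfolding S_def of_real_sum by (intro sum.cong refl) (rule complex_norm_square[symmetric])
  have "L2_inner M e f = cnj (c e)" for e
    unfolding c_def by (rule L2_inner_commute)
  then have sf: "L2_inner M s f = of_real S"
    unfolding inner_s[OF f] using cS by simp
  have "L2_inner M e s = cnj (c e)" if "e \<in> F" for e
    using se[OF that] L2_inner_commute by metis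
  then have ss: "L2_inner M s s = of_real S"
    unfolding inner_s[OF s] using cS by simp
  have fs: "L2_inner M f s = of_real S"
    using sf L2_inner_commute[of M f s] by simp
  have "complex_of_real ((L2_norm M (\<lambda>x. f x - s x))\<^sup>2) = of_real ((L2_norm M f)\<^sup>2 - S)"
    unfolding L2_inner_self[symmetric]
    using f s L2_diff[OF f s] fs sf ss
    by (simp add: L2_inner_diff_left L2_inner_diff_right) (simp add: L2_inner_self)
  then have "(L2_norm M (\<lambda>x. f x - s x))\<^sup>2 = (L2_norm M f)\<^sup>2 - S"
    by (simp only: of_real_eq_iff)
  then show ?thesis
    using zero_le_power2[of "L2_norm M (\<lambda>x. f x - s x)"] by (simp add: S_def c_def)
qed

text \<open>This is Bessel's inequality for the single vector g / |g|. If g has norm 0, it vanishes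
  almost everywhere and so does the inner product.\<close>

lemma L2_Cauchy_Schwarz:
  assumes "f \<in> L2 M" "g \<in> L2 M"
  shows "cmod (L2_inner M f g) \<le> L2_norm M f * L2_norm M g"
proof (cases "L2_norm M g = 0")
  case True
  then have "L2_inner M g f = L2_inner M (\<lambda>_. 0) f"
    using assms by (intro L2_inner_cong_left) (auto simp: L2_norm_eq_0_iff L2_zero)
  then show ?thesis
    using True L2_inner_commute[of M f g] by simp
next
  case False
  define e where "e = (\<lambda>x. complex_of_real (inverse (L2_norm M g)) * g x)"
  have "L2_norm M e = 1"
    using False by (simp add: e_def L2_norm_scale del: of_real_inverse)
  then have "L2_inner M e e = 1" by (simp add: L2_inner_self)
  then have "L2_orthonormal M {e}"
    using assms by (simp add: L2_orthonormal_def e_def L2_scale)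
  from L2_bessel[OF this _ assms(1)]
  have "(cmod (L2_inner M f e))\<^sup>2 \<le> (L2_norm M f)\<^sup>2" by simp
  then have "cmod (L2_inner M f e) \<le> L2_norm M f"
    by (rule power2_le_imp_le) simp
  then have "cmod (L2_inner M f g) / L2_norm M g \<le> L2_norm M f"
    unfolding e_def L2_inner_scale_right by (simp add: norm_mult norm_inverse norm_divide field_simps)
  then show ?thesis
    using False by (simp add: field_simps L2_norm_nonneg less_le)
qed

lemma L2_norm_triangle:
  assumes "f \<in> L2 M" "g \<in> L2 M"
  shows "L2_norm M (\<lambda>x. f x + g x) \<le> L2_norm M f + L2_norm M g"
proof (rule power2_le_imp_le)
  let ?r = "Re (L2_inner M f g)"
  have "complex_of_real ((L2_norm M (\<lambda>x. f x + g x))\<^sup>2)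
      = L2_inner M f f + L2_inner M g g + (L2_inner M f g + cnj (L2_inner M f g))"
    unfolding L2_inner_self[symmetric]
    using assms L2_add[OF assms] L2_inner_commute[of M g f]
    by (simp add: L2_inner_add_left L2_inner_add_right)
  then have "Re (complex_of_real ((L2_norm M (\<lambda>x. f x + g x))\<^sup>2))
      = (L2_norm M f)\<^sup>2 + (L2_norm M g)\<^sup>2 + 2 * ?r"
    unfolding L2_inner_self by simp
  moreover have "?r \<le> L2_norm M f * L2_norm M g"
    using complex_Re_le_cmod[of "L2_inner M f g"] L2_Cauchy_Schwarz[OF assms] by linarith
  ultimately show "(L2_norm M (\<lambda>x. f x + g x))\<^sup>2 \<le> (L2_norm M f + L2_norm M g)\<^sup>2"
    by (simp add: power2_sum)
qed simp

lemma L2_norm_diff_bound: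
  assumes "f \<in> L2 M" "g \<in> L2 M"
  shows "\<bar>L2_norm M f - L2_norm M g\<bar> \<le> L2_norm M (\<lambda>x. f x - g x)"
proof -
  have d: "(\<lambda>x. f x - g x) \<in> L2 M" "(\<lambda>x. - 1 * (f x - g x)) \<in> L2 M"
    using assms by (auto intro!: L2_diff L2_scale simp del: mult_minus1)
  have "L2_norm M f \<le> L2_norm M (\<lambda>x. f x - g x) + L2_norm M g"
    using L2_norm_triangle[OF d(1) assms(2)] by simp
  moreover have "L2_norm M g \<le> L2_norm M (\<lambda>x. f x - g x) + L2_norm M f"
    using L2_norm_triangle[OF d(2) assms(1)] unfolding L2_norm_scale by simp
  ultimately show ?thesis by linarith
qed

lemma (in finite_measure) L2_bounded:
  assumes "f \<in> borel_measurable M" "\<And>x. x \<in> space M \<Longrightarrow> cmod (f x) \<le> B"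
  shows "f \<in> L2 M"
proof (rule L2I)
  show "integrable M (\<lambda>x. (cmod (f x))\<^sup>2)"
  proof (rule integrable_const_bound)
    show "AE x in M. norm ((cmod (f x))\<^sup>2) \<le> B\<^sup>2"
      using assms by (intro AE_I2) (simp add: power_mono)
  qed (use assms in simp)
qed fact

lemma (in finite_measure) L2_norm_bounded:
  assumes "f \<in> borel_measurable M" "0 \<le> B" "\<And>x. x \<in> space M \<Longrightarrow> cmod (f x) \<le> B"
  shows "L2_norm M f \<le> B * sqrt (measure M (space M))"
proof -
  have "(LINT x|M. (cmod (f x))\<^sup>2) \<le> (LINT x|M. B\<^sup>2)"
  proof (rule integral_mono)
    show "integrable M (\<lambda>x. (cmod (f x))\<^sup>2)"
      using L2_bounded[OF assms(1,3)] by (rule L2_integrable_square)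
  qed (use assms in \<open>auto simp: power_mono\<close>)
  then have "L2_norm M f \<le> sqrt (B\<^sup>2 * measure M (space M))"
    unfolding L2_norm_def by (intro real_sqrt_le_mono) (simp add: mult.commute)
  then show ?thesis using assms by (simp add: real_sqrt_mult)
qed

lemma (in finite_measure) L2_integrable:
  assumes "f \<in> L2 M"
  shows "integrable M f"
proof -
  have "(\<lambda>_. 1) \<in> L2 M" by (rule L2_bounded) auto
  from L2_mult_integrable[OF assms this] show ?thesis by simp
qed

lemma L2_tendsto_inner:
  assumes "\<And>n. f n \<in> L2 M" "h \<in> L2 M" "g \<in> L2 M"
    and "(\<lambda>n. L2_norm M (\<lambda>x. f n x - h x)) \<longlonglongrightarrow> 0"
  shows "(\<lambda>n. L2_inner M (f n) g) \<longlonglongrightarrow> L2_inner M h g"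
proof (rule Lim_transform2[OF tendsto_const])
  have "(\<lambda>n. L2_norm M (\<lambda>x. f n x - h x) * L2_norm M g) \<longlonglongrightarrow> 0"
    using tendsto_mult_right[OF assms(4)] by simp
  then show "(\<lambda>n. L2_inner M h g - L2_inner M (f n) g) \<longlonglongrightarrow> 0"
  proof (rule Lim_null_comparison[rotated])
    show "\<forall>\<^sub>F n in sequentially. norm (L2_inner M h g - L2_inner M (f n) g)
        \<le> L2_norm M (\<lambda>x. f n x - h x) * L2_norm M g"
      using L2_Cauchy_Schwarz[OF L2_diff[OF assms(1,2)] assms(3)] assms(1-3)
      by (simp add: L2_inner_diff_left norm_minus_commute)
  qed
qed

lemma L2_tendsto_norm:
  assumes "\<And>n. f n \<in> L2 M" "h \<in> L2 M"
    and "(\<lambda>n. L2_norm M (\<lambda>x. f n x - h x)) \<longlonglongrightarrow> 0"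
  shows "(\<lambda>n. L2_norm M (f n)) \<longlonglongrightarrow> L2_norm M h"
proof (rule Lim_transform2[OF tendsto_const])
  show "(\<lambda>n. L2_norm M h - L2_norm M (f n)) \<longlonglongrightarrow> 0"
    using assms(3)
  proof (rule Lim_null_comparison[rotated])
    show "\<forall>\<^sub>F n in sequentially. norm (L2_norm M h - L2_norm M (f n)) \<le> L2_norm M (\<lambda>x. f n x - h x)"
      using L2_norm_diff_bound[OF assms(1,2)] by (simp add: abs_minus_commute)
  qed
qed

section \<open>Compact Hermitian integral operators\<close>

lemma L2_norm_diff_square:
  assumes "f \<in> L2 M" "g \<in> L2 M"
  shows "(L2_norm M (\<lambda>x. f x - g x))\<^sup>2
    = (L2_norm M f)\<^sup>2 + (L2_norm M g)\<^sup>2 - 2 * Re (L2_inner M f g)"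
proof -
  have "complex_of_real ((L2_norm M (\<lambda>x. f x - g x))\<^sup>2)
      = L2_inner M f f + L2_inner M g g - (L2_inner M f g + cnj (L2_inner M f g))"
    unfolding L2_inner_self[symmetric]
    using assms L2_diff[OF assms] L2_inner_commute[of M g f]
    by (simp add: L2_inner_diff_left L2_inner_diff_right)
  then have "Re (complex_of_real ((L2_norm M (\<lambda>x. f x - g x))\<^sup>2))
      = (L2_norm M f)\<^sup>2 + (L2_norm M g)\<^sup>2 - 2 * Re (L2_inner M f g)"
    unfolding L2_inner_self by simp
  then show ?thesis by simp
qed

section \<open>Integral operators with a bounded kernel\<close>

lemma (in pair_sigma_finite) integrable_product_mult:
  fixes f :: "'a \<Rightarrow> complex" and g :: "'b \<Rightarrow> complex"
  assumes "integrable M1 f" "integrable M2 g"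
  shows "integrable (M1 \<Otimes>\<^sub>M M2) (\<lambda>(x, y). f x * g y)"
proof (rule Fubini_integrable)
  have [measurable]: "f \<in> borel_measurable M1" "g \<in> borel_measurable M2"
    using assms by auto
  show "(\<lambda>(x, y). f x * g y) \<in> borel_measurable (M1 \<Otimes>\<^sub>M M2)" by measurable
  show "integrable M1 (\<lambda>x. LINT y|M2. norm (case (x, y) of (x, y) \<Rightarrow> f x * g y))"
    using assms by (simp add: norm_mult)
  show "AE x in M1. integrable M2 (\<lambda>y. case (x, y) of (x, y) \<Rightarrow> f x * g y)"
    using assms by simp
qed

text \<open>Supplies the integrability hypothesis for the exchanges of integrals by Fubini below: a
  bounded kernel is dominated by a constant times the product of two integrable functions.\<close>

lemma (in pair_sigma_finite) integrable_bounded_kernel_mult: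
  fixes f :: "'a \<Rightarrow> complex" and g :: "'b \<Rightarrow> complex"
  assumes [measurable]: "(\<lambda>(x, y). k x y) \<in> borel_measurable (M1 \<Otimes>\<^sub>M M2)"
    and k: "\<And>x y. x \<in> space M1 \<Longrightarrow> y \<in> space M2 \<Longrightarrow> cmod (k x y) \<le> B"
    and fg: "integrable M1 f" "integrable M2 g"
  shows "integrable (M1 \<Otimes>\<^sub>M M2) (\<lambda>(x, y). k x y * (f x * g y))"
proof (rule Bochner_Integration.integrable_bound)
  have [measurable]: "f \<in> borel_measurable M1" "g \<in> borel_measurable M2"
    using fg by auto
  show "integrable (M1 \<Otimes>\<^sub>M M2) (\<lambda>z. complex_of_real B * (case z of (x, y) \<Rightarrow> f x * g y))"
    using integrable_product_mult[OF fg] by (rule integrable_mult_right)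
  show "(\<lambda>(x, y). k x y * (f x * g y)) \<in> borel_measurable (M1 \<Otimes>\<^sub>M M2)" by measurable
  show "AE z in M1 \<Otimes>\<^sub>M M2. norm (case z of (x, y) \<Rightarrow> k x y * (f x * g y))
      \<le> norm (complex_of_real B * (case z of (x, y) \<Rightarrow> f x * g y))"
  proof (rule AE_I2)
    fix z assume "z \<in> space (M1 \<Otimes>\<^sub>M M2)"
    then obtain x y where "z = (x, y)" "x \<in> space M1" "y \<in> space M2"
      by (auto simp: space_pair_measure)
    moreover have "cmod (k x y) \<le> \<bar>B\<bar>" using calculation k[of x y] by linarith
    ultimately show "norm (case z of (x, y) \<Rightarrow> k x y * (f x * g y))
      \<le> norm (complex_of_real B * (case z of (x, y) \<Rightarrow> f x * g y))"
      by (simp add: norm_mult mult_right_mono)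
  qed
qed

text \<open>\<open>T\<close> is a parameter that has to agree with the integral only on
  \<open>L2 M\<close> and on \<open>space M\<close>. An operator given by another formula, with
  arbitrary values elsewhere, can thus be interpreted directly.\<close>

locale bounded_kernel = finite_measure M for M :: "'a measure" +
  fixes K :: "'a \<Rightarrow> 'a \<Rightarrow> complex" and \<kappa> :: real
    and T :: "('a \<Rightarrow> complex) \<Rightarrow> 'a \<Rightarrow> complex"
  assumes K_measurable [measurable]: "(\<lambda>(t, u). K t u) \<in> borel_measurable (M \<Otimes>\<^sub>M M)"
    and \<kappa>_nonneg: "0 \<le> \<kappa>"
    and K_bound: "\<And>t u. t \<in> space M \<Longrightarrow> u \<in> space M \<Longrightarrow> cmod (K t u) \<le> \<kappa>"
    and T_eq: "\<And>f t. f \<in> L2 M \<Longrightarrow> t \<in> space M \<Longrightarrow> T f t = (LINT u|M. K t u * f u)"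
begin

definition sqrt_mass where "sqrt_mass = sqrt (measure M (space M))"

lemma sqrt_mass_nonneg: "0 \<le> sqrt_mass" by (simp add: sqrt_mass_def)

lemma row_L2:
  assumes "t \<in> space M"
  shows "(\<lambda>u. cnj (K t u)) \<in> L2 M"
proof (rule L2_bounded)
  show "(\<lambda>u. cnj (K t u)) \<in> borel_measurable M"
    using measurable_compose[OF measurable_Pair1'[OF assms] K_measurable] by simp
qed (use assms K_bound in auto)

lemma row_norm:
  assumes "t \<in> space M"
  shows "L2_norm M (\<lambda>u. cnj (K t u)) \<le> \<kappa> * sqrt_mass"
  unfolding sqrt_mass_def
  by (rule L2_norm_bounded) (use assms K_bound \<kappa>_nonneg L2_measurable[OF row_L2] in auto)

text \<open>Evaluation of \<open>T f\<close> at a point is a bounded functional represented by the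
  conjugated row of the kernel. For this reason the identities for \<open>T\<close> below hold at
  every point of the space and not merely almost everywhere, and \<open>T f t\<close> does not
  depend on the representative of \<open>f\<close>.\<close>

lemma T_inner: "f \<in> L2 M \<Longrightarrow> t \<in> space M \<Longrightarrow> T f t = L2_inner M f (\<lambda>u. cnj (K t u))"
  by (simp add: T_eq L2_inner_def mult.commute)

lemma T_bound:
  assumes "f \<in> L2 M" "t \<in> space M"
  shows "cmod (T f t) \<le> \<kappa> * sqrt_mass * L2_norm M f"
proof -
  have "cmod (T f t) \<le> L2_norm M f * L2_norm M (\<lambda>u. cnj (K t u))"
    unfolding T_inner[OF assms] by (rule L2_Cauchy_Schwarz[OF assms(1) row_L2[OF assms(2)]])
  also have "\<dots> \<le> L2_norm M f * (\<kappa> * sqrt_mass)"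
    by (intro mult_left_mono row_norm assms) simp
  finally show ?thesis by (simp add: mult.commute)
qed

lemma T_measurable:
  assumes "f \<in> L2 M"
  shows "T f \<in> borel_measurable M"
proof -
  have [measurable]: "f \<in> borel_measurable M" using assms by (rule L2_measurable)
  have "(\<lambda>t. LINT u|M. K t u * f u) \<in> borel_measurable M" by measurable
  then show ?thesis
    by (subst measurable_cong[OF T_eq[OF assms]])
qed

lemma T_L2: "f \<in> L2 M \<Longrightarrow> T f \<in> L2 M"
  by (rule L2_bounded[OF T_measurable T_bound])

lemma T_norm:
  assumes "f \<in> L2 M"
  shows "L2_norm M (T f) \<le> \<kappa> * sqrt_mass\<^sup>2 * L2_norm M f"
proof -
  have "L2_norm M (T f) \<le> (\<kappa> * sqrt_mass * L2_norm M f) * sqrt (measure M (space M))"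
    by (rule L2_norm_bounded) (use assms T_measurable T_bound \<kappa>_nonneg sqrt_mass_nonneg in auto)
  then show ?thesis by (simp add: sqrt_mass_def[symmetric] power2_eq_square mult_ac)
qed

lemma T_scale: "f \<in> L2 M \<Longrightarrow> t \<in> space M \<Longrightarrow> T (\<lambda>x. c * f x) t = c * T f t"
  by (simp add: T_inner L2_scale L2_inner_scale_left)

lemma T_add:
  "f \<in> L2 M \<Longrightarrow> g \<in> L2 M \<Longrightarrow> t \<in> space M \<Longrightarrow> T (\<lambda>x. f x + g x) t = T f t + T g t"
  by (simp add: T_inner L2_add L2_inner_add_left row_L2)

lemma T_diff:
  "f \<in> L2 M \<Longrightarrow> g \<in> L2 M \<Longrightarrow> t \<in> space M \<Longrightarrow> T (\<lambda>x. f x - g x) t = T f t - T g t"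
  by (simp add: T_inner L2_diff L2_inner_diff_left row_L2)

lemma T_cong:
  "L2_eq M f g \<Longrightarrow> f \<in> L2 M \<Longrightarrow> g \<in> L2 M \<Longrightarrow> t \<in> space M \<Longrightarrow> T f t = T g t"
  unfolding T_inner by (rule L2_inner_cong_left) (auto simp: row_L2)

lemma T_bounded_linear: "L2_bounded_linear M T"
  unfolding L2_bounded_linear_def
proof (intro conjI ballI allI impI exI)
  show "L2_norm M (T f) \<le> \<kappa> * sqrt_mass\<^sup>2 * L2_norm M f" if "f \<in> L2 M" for f
    using that by (rule T_norm)
qed (auto intro!: L2_eqI T_L2 T_add T_scale intro: T_cong)

end

locale hermitian_kernel = bounded_kernel +
  assumes K_hermitian: "\<And>t u. t \<in> space M \<Longrightarrow> u \<in> space M \<Longrightarrow> K u t = cnj (K t u)"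
begin

text \<open>Fubini exchanges the two integrals, and Hermitian symmetry turns the transposed kernel
  back into the kernel of \<open>T g\<close>. Integrability is clear since square integrable
  functions are integrable on a finite measure space and \<open>K\<close> is bounded.\<close>

lemma T_symmetric:
  assumes f: "f \<in> L2 M" and g: "g \<in> L2 M"
  shows "L2_inner M (T f) g = L2_inner M f (T g)"
proof -
  interpret P: pair_sigma_finite M M ..
  let ?h = "\<lambda>t u. K t u * (cnj (g t) * f u)"
  have int: "integrable (M \<Otimes>\<^sub>M M) (\<lambda>(t, u). ?h t u)"
    by (rule P.integrable_bounded_kernel_mult[OF K_measurable K_bound])
       (use f g L2_integrable L2_cnj in auto)
  have "L2_inner M (T f) g = (LINT t|M. LINT u|M. ?h t u)"
    unfolding L2_inner_def
  proof (intro Bochner_Integration.integral_cong refl)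
    fix t assume t: "t \<in> space M"
    have "T f t * cnj (g t) = (LINT u|M. K t u * f u * cnj (g t))"
      unfolding T_eq[OF f t] integral_mult_left_zero ..
    then show "T f t * cnj (g t) = (LINT u|M. ?h t u)"
      by (simp add: mult_ac)
  qed
  also have "\<dots> = (LINT u|M. LINT t|M. ?h t u)"
    by (rule P.Fubini_integral[OF int, symmetric])
  also have "\<dots> = L2_inner M f (T g)"
    unfolding L2_inner_def
  proof (intro Bochner_Integration.integral_cong refl)
    fix u assume u: "u \<in> space M"
    have "f u * cnj (T g u) = (LINT t|M. f u * cnj (K u t * g t))"
      unfolding T_eq[OF g u] Bochner_Integration.integral_cnj integral_mult_right_zero ..
    also have "\<dots> = (LINT t|M. ?h t u)"
      by (intro Bochner_Integration.integral_cong refl) (simp add: K_hermitian[OF _ u] mult_ac)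
    finally show "(LINT t|M. ?h t u) = f u * cnj (T g u)" by simp
  qed
  finally show ?thesis .
qed

lemma T_adjoint: "L2_adjoint M T T"
  unfolding L2_adjoint_def using T_bounded_linear T_symmetric by blast

end

text \<open>Compactness is sequential, on unit vectors, and provides the limit \<open>h\<close>
  itself, so that no Cauchy sequence has to be completed in L^2.\<close>

locale compact_hermitian_kernel = hermitian_kernel +
  assumes compact: "\<And>f. (\<And>n. f n \<in> L2 M) \<Longrightarrow> (\<And>n. L2_norm M (f n) = 1) \<Longrightarrow>
    \<exists>h\<in>L2 M. \<exists>r. strict_mono (r :: nat \<Rightarrow> nat) \<and> (\<lambda>n. L2_norm M (\<lambda>x. T (f (r n)) x - h x)) \<longlonglongrightarrow> 0"
begin

text \<open>Expand the square. By symmetry the mixed term is -2 \<mu>^2 |T f|^2, and the assumption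
  bounds |T (T f)|^2 by \<mu>^2 |T f|^2. As |T f| approaches \<mu>, the vector f becomes an
  approximate eigenvector of T^2 for \<mu>^2.\<close>

lemma norm_T_defect:
  assumes f: "f \<in> L2 M" "L2_norm M f = 1" and "0 \<le> \<mu>"
    and le: "L2_norm M (T (T f)) \<le> \<mu> * L2_norm M (T f)"
  shows "(L2_norm M (\<lambda>x. of_real (\<mu>\<^sup>2) * f x - T (T f) x))\<^sup>2 \<le> \<mu>\<^sup>2 * (\<mu>\<^sup>2 - (L2_norm M (T f))\<^sup>2)"
proof -
  let ?c = "complex_of_real (\<mu>\<^sup>2)"
  have "L2_inner M (\<lambda>x. ?c * f x) (T (T f)) = ?c * of_real ((L2_norm M (T f))\<^sup>2)"
    unfolding L2_inner_scale_left using T_symmetric[OF f(1) T_L2[OF f(1)]] L2_inner_self[of M "T f"] by simp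
  then have "Re (L2_inner M (\<lambda>x. ?c * f x) (T (T f))) = \<mu>\<^sup>2 * (L2_norm M (T f))\<^sup>2"
    by (simp only: of_real_mult[symmetric] Re_complex_of_real)
  moreover have "L2_norm M (\<lambda>x. ?c * f x) = \<mu>\<^sup>2"
    unfolding L2_norm_scale using f by (simp add: norm_power)
  moreover have "(L2_norm M (T (T f)))\<^sup>2 \<le> (\<mu> * L2_norm M (T f))\<^sup>2"
    using le by (intro power_mono) auto
  ultimately show ?thesis
    unfolding L2_norm_diff_square[OF L2_scale[OF f(1)] T_L2[OF T_L2[OF f(1)]]]
    by (simp add: power_mult_distrib algebra_simps power2_eq_square)
qed

text \<open>
  A maximizing sequence for \<open>\<parallel>T f\<parallel>\<close> on the orthogonal complement of \<open>E\<close> is asymptotically an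
  eigenvector of \<open>T\<^sup>2\<close> for \<open>\<mu>\<^sup>2\<close>; by compactness a genuine eigenvector \<open>g\<close> of \<open>T\<^sup>2\<close> exists, and then
  \<open>T g + \<mu> g\<close> or \<open>g\<close> is one of \<open>T\<close>.
\<close>

lemma eigenvector_exists:
  assumes E: "E \<subseteq> L2 M" "\<And>e. e \<in> E \<Longrightarrow> \<exists>c. L2_eq M (T e) (\<lambda>x. c * e x)"
    and f0: "f0 \<in> L2 M" "\<And>e. e \<in> E \<Longrightarrow> L2_inner M f0 e = 0" "L2_norm M f0 \<noteq> 0"
  obtains v c where "v \<in> L2 M" "\<And>e. e \<in> E \<Longrightarrow> L2_inner M v e = 0" "L2_norm M v \<noteq> 0"
    "L2_eq M (T v) (\<lambda>x. c * v x)"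
proof -
  define W where "W = {f \<in> L2 M. \<forall>e\<in>E. L2_inner M f e = 0}"
  have W_L2: "f \<in> L2 M" if "f \<in> W" for f using that by (simp add: W_def)
  have W_scale: "(\<lambda>x. c * f x) \<in> W" if "f \<in> W" for c f
    using that by (simp add: W_def L2_scale L2_inner_scale_left)
  have W_add: "(\<lambda>x. f x + g x) \<in> W" if "f \<in> W" "g \<in> W" for f g
    using that E(1) by (auto simp: W_def L2_add L2_inner_add_left subset_iff)
  \<comment> \<open>The orthogonal complement \<open>W\<close> is invariant: moving \<open>T\<close>
    over to the eigenvector \<open>e\<close> only multiplies <f, e> = 0 by a scalar.\<close>
  have W_T: "T f \<in> W" if f: "f \<in> W" for f
  proof -
    have "L2_inner M (T f) e = 0" if e: "e \<in> E" for e
    proof -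
      obtain c where c: "L2_eq M (T e) (\<lambda>x. c * e x)" using E(2)[OF e] by blast
      have eL: "e \<in> L2 M" using E(1) e by blast
      have "L2_inner M (T f) e = cnj (L2_inner M (T e) f)"
        using T_symmetric[OF W_L2[OF f] eL] L2_inner_commute by metis
      also have "L2_inner M (T e) f = L2_inner M (\<lambda>x. c * e x) f"
        by (intro L2_inner_cong_left c T_L2 L2_scale eL W_L2 f)
      also have "\<dots> = c * cnj (L2_inner M f e)"
        using L2_inner_commute[of M e f] by (simp add: L2_inner_scale_left)
      finally show ?thesis using f e by (simp add: W_def)
    qed
    then show ?thesis using f T_L2 by (auto simp: W_def)
  qed
  define S where "S = {L2_norm M (T f) |f. f \<in> W \<and> L2_norm M f = 1}"
  have unit: "(\<lambda>x. of_real (inverse (L2_norm M f)) * f x) \<in> W"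
       "L2_norm M (\<lambda>x. of_real (inverse (L2_norm M f)) * f x) = 1"
    if "f \<in> W" "L2_norm M f \<noteq> 0" for f
    using that W_scale by (simp_all add: L2_norm_scale del: of_real_inverse)
  have f0W: "f0 \<in> W" using f0 by (simp add: W_def)
  have S_ne: "S \<noteq> {}" using unit[OF f0W f0(3)] by (auto simp: S_def)
  have S_bdd: "bdd_above S"
    unfolding S_def bdd_above_def using T_norm W_L2 by fastforce
  define \<mu> where "\<mu> = Sup S"
  have \<mu>_upper: "L2_norm M (T f) \<le> \<mu> * L2_norm M f" if f: "f \<in> W" for f
  proof (cases "L2_norm M f = 0")
    case True
    then show ?thesis using T_norm[OF W_L2[OF f]] by simp
  next
    case False
    let ?f = "\<lambda>x. of_real (inverse (L2_norm M f)) * f x"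
    have "L2_norm M (T ?f) \<le> \<mu>"
      unfolding \<mu>_def by (rule cSup_upper[OF _ S_bdd]) (use unit[OF f False] in \<open>auto simp: S_def\<close>)
    moreover have "L2_norm M (T ?f) = L2_norm M (\<lambda>x. of_real (inverse (L2_norm M f)) * T f x)"
      by (intro L2_norm_cong L2_eqI T_scale T_L2 L2_scale W_L2 f)
    ultimately have "L2_norm M (T f) / L2_norm M f \<le> \<mu>"
      unfolding L2_norm_scale by (simp add: norm_inverse divide_inverse mult.commute)
    then show ?thesis using False by (simp add: pos_divide_le_eq less_le)
  qed
  have "0 \<le> \<mu>"
    using \<mu>_upper[OF f0W] f0(3) by (smt (verit) L2_norm_nonneg mult_neg_pos)
  then consider "\<mu> = 0" | "\<mu> > 0" by linarith
  then show thesis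
  proof cases
    \<comment> \<open>Here \<open>T\<close> annihilates \<open>W\<close>, so \<open>f0\<close>
      itself is an eigenvector for the eigenvalue 0.\<close>
    case 1
    then have "L2_norm M (T f0) = 0" using \<mu>_upper[OF f0W] by (simp add: order_antisym)
    then have "L2_eq M (T f0) (\<lambda>x. 0 * f0 x)"
      using L2_norm_eq_0_iff[OF T_L2[OF f0(1)]] by simp
    with f0 that show ?thesis by blast
  next
    case 2
    have "\<exists>f. f \<in> W \<and> L2_norm M f = 1 \<and> L2_norm M (T f) > \<mu> - 1 / Suc n" for n
    proof -
      have "\<mu> - 1 / Suc n < Sup S" by (simp add: \<mu>_def)
      then show ?thesis
        using less_cSupE[OF _ S_ne] unfolding S_def by blast
    qed
    then obtain f where f: "\<And>n. f n \<in> W" "\<And>n. L2_norm M (f n) = 1"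
        "\<And>n. L2_norm M (T (f n)) > \<mu> - 1 / Suc n" by metis
    obtain h r where h: "h \<in> L2 M" and r: "strict_mono r"
      and lim: "(\<lambda>n. L2_norm M (\<lambda>x. T (f (r n)) x - h x)) \<longlonglongrightarrow> 0"
      using compact[of f, OF W_L2[OF f(1)] f(2)] by blast
    define k where "k n = f (r n)" for n
    have kL [simp]: "k n \<in> L2 M" "T (k n) \<in> L2 M" "T (T (k n)) \<in> L2 M" for n
      using f W_L2 T_L2 by (simp_all add: k_def)
    have norm_T_k: "(\<lambda>n. L2_norm M (T (k n))) \<longlonglongrightarrow> \<mu>"
    proof (rule tendsto_sandwich)
      show "\<forall>\<^sub>F n in sequentially. \<mu> - 1 / Suc (r n) \<le> L2_norm M (T (k n))"
        using f(3) by (simp add: k_def less_imp_le)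
      show "\<forall>\<^sub>F n in sequentially. L2_norm M (T (k n)) \<le> \<mu>"
        using \<mu>_upper[OF f(1)] f(2) by (simp add: k_def)
      have "(\<lambda>n. \<mu> - 1 / Suc n) \<longlonglongrightarrow> \<mu> - 0"
        by (intro tendsto_diff tendsto_const LIMSEQ_Suc lim_1_over_n)
      from LIMSEQ_subseq_LIMSEQ[OF this r] show "(\<lambda>n. \<mu> - 1 / Suc (r n)) \<longlonglongrightarrow> \<mu>"
        by (simp add: o_def)
    qed simp
    define c where "c = complex_of_real (\<mu>\<^sup>2)"
    have "c \<noteq> 0" using 2 by (simp add: c_def)
    \<comment> \<open>The limit of \<open>k n\<close> is forced: \<open>T (T (k n))\<close> is close
      to \<open>c * k n\<close> by the defect bound and close to \<open>T h\<close> by continuity of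
      \<open>T\<close>, so \<open>k n\<close> must converge to
      \<open>inverse c * T h\<close>.\<close>
    define g where "g x = inverse c * T h x" for x
    have g [simp]: "g \<in> L2 M" unfolding g_def by (intro L2_scale T_L2 h)
    have d1: "(\<lambda>n. L2_norm M (\<lambda>x. c * k n x - T (T (k n)) x)) \<longlonglongrightarrow> 0"
    proof -
      have "(\<lambda>n. \<mu>\<^sup>2 * (\<mu>\<^sup>2 - (L2_norm M (T (k n)))\<^sup>2)) \<longlonglongrightarrow> \<mu>\<^sup>2 * (\<mu>\<^sup>2 - \<mu>\<^sup>2)"
        by (intro tendsto_intros norm_T_k)
      then have "(\<lambda>n. \<mu>\<^sup>2 * (\<mu>\<^sup>2 - (L2_norm M (T (k n)))\<^sup>2)) \<longlonglongrightarrow> 0" by simp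
      then have "(\<lambda>n. (L2_norm M (\<lambda>x. c * k n x - T (T (k n)) x))\<^sup>2) \<longlonglongrightarrow> 0"
      proof (rule Lim_null_comparison[rotated])
        show "\<forall>\<^sub>F n in sequentially. norm ((L2_norm M (\<lambda>x. c * k n x - T (T (k n)) x))\<^sup>2)
            \<le> \<mu>\<^sup>2 * (\<mu>\<^sup>2 - (L2_norm M (T (k n)))\<^sup>2)"
          using norm_T_defect[OF kL(1) _ less_imp_le[OF 2] \<mu>_upper[OF W_T]] f
          by (simp add: k_def c_def)
      qed
      from tendsto_real_sqrt[OF this] show ?thesis by simp
    qed
    have d2: "(\<lambda>n. L2_norm M (\<lambda>x. T (T (k n)) x - T h x)) \<longlonglongrightarrow> 0"
    proof (rule Lim_null_comparison)
      show "\<forall>\<^sub>F n in sequentially. norm (L2_norm M (\<lambda>x. T (T (k n)) x - T h x))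
          \<le> \<kappa> * sqrt_mass\<^sup>2 * L2_norm M (\<lambda>x. T (k n) x - h x)"
      proof (intro always_eventually allI)
        fix n
        have "L2_norm M (\<lambda>x. T (T (k n)) x - T h x) = L2_norm M (T (\<lambda>x. T (k n) x - h x))"
          by (intro L2_norm_cong L2_eqI T_diff[symmetric] L2_diff T_L2 kL h)
        then show "norm (L2_norm M (\<lambda>x. T (T (k n)) x - T h x))
          \<le> \<kappa> * sqrt_mass\<^sup>2 * L2_norm M (\<lambda>x. T (k n) x - h x)"
          using T_norm[OF L2_diff[OF kL(2) h]] by simp
      qed
      show "(\<lambda>n. \<kappa> * sqrt_mass\<^sup>2 * L2_norm M (\<lambda>x. T (k n) x - h x)) \<longlonglongrightarrow> 0"
        using tendsto_mult_right_zero[OF lim] by (simp add: k_def)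
    qed
    have k_g: "(\<lambda>n. L2_norm M (\<lambda>x. k n x - g x)) \<longlonglongrightarrow> 0"
    proof (rule Lim_null_comparison)
      let ?b = "\<lambda>n. cmod (inverse c) * (L2_norm M (\<lambda>x. c * k n x - T (T (k n)) x)
          + L2_norm M (\<lambda>x. T (T (k n)) x - T h x))"
      show "\<forall>\<^sub>F n in sequentially. norm (L2_norm M (\<lambda>x. k n x - g x)) \<le> ?b n"
      proof (intro always_eventually allI)
        fix n
        have "(\<lambda>x. k n x - g x) = (\<lambda>x. inverse c * ((c * k n x - T (T (k n)) x) + (T (T (k n)) x - T h x)))"
          using \<open>c \<noteq> 0\<close> by (simp add: g_def fun_eq_iff field_simps)
        then have "L2_norm M (\<lambda>x. k n x - g x)
            = cmod (inverse c) * L2_norm M (\<lambda>x. (c * k n x - T (T (k n)) x) + (T (T (k n)) x - T h x))"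
          by (simp only: L2_norm_scale)
        also have "\<dots> \<le> ?b n"
          by (intro mult_left_mono L2_norm_triangle L2_diff L2_scale kL T_L2 h) simp
        finally show "norm (L2_norm M (\<lambda>x. k n x - g x)) \<le> ?b n" by simp
      qed
      show "?b \<longlonglongrightarrow> 0"
        using tendsto_mult_right_zero[OF tendsto_add_zero[OF d1 d2]] by simp
    qed
    have gW: "g \<in> W"
    proof -
      have "L2_inner M g e = 0" if "e \<in> E" for e
      proof -
        have "(\<lambda>n. L2_inner M (k n) e) \<longlonglongrightarrow> L2_inner M g e"
          by (rule L2_tendsto_inner[OF kL(1) g _ k_g]) (use E that in auto)
        moreover have "L2_inner M (k n) e = 0" for n
          using f(1) that by (simp add: k_def W_def)
        ultimately show ?thesis by (simp add: LIMSEQ_const_iff)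
      qed
      then show ?thesis by (simp add: W_def)
    qed
    have "(\<lambda>n. L2_norm M (k n)) \<longlonglongrightarrow> L2_norm M g"
      by (rule L2_tendsto_norm[OF kL(1) g k_g])
    then have norm_g: "L2_norm M g = 1" using f(2) by (simp add: k_def LIMSEQ_const_iff)
    have hTg: "L2_eq M h (T g)"
    proof -
      have "(\<lambda>n. L2_norm M (\<lambda>x. h x - T g x)) \<longlonglongrightarrow> 0"
      proof (rule Lim_null_comparison)
        let ?b = "\<lambda>n. L2_norm M (\<lambda>x. T (k n) x - h x) + \<kappa> * sqrt_mass\<^sup>2 * L2_norm M (\<lambda>x. k n x - g x)"
        show "\<forall>\<^sub>F n in sequentially. norm (L2_norm M (\<lambda>x. h x - T g x)) \<le> ?b n"
        proof (intro always_eventually allI)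
          fix n
          have "L2_norm M (\<lambda>x. h x - T g x)
             = L2_norm M (\<lambda>x. - 1 * (T (k n) x - h x) + T (\<lambda>x. k n x - g x) x)"
            by (intro L2_norm_cong L2_eqI L2_add L2_diff L2_scale kL T_L2 h g)
               (simp add: T_diff)
          also have "\<dots> \<le> L2_norm M (\<lambda>x. - 1 * (T (k n) x - h x)) + L2_norm M (T (\<lambda>x. k n x - g x))"
            by (intro L2_norm_triangle L2_diff L2_scale kL T_L2 h g)
          also have "\<dots> \<le> ?b n"
            unfolding L2_norm_scale using T_norm[OF L2_diff[OF kL(1) g]] by simp
          finally show "norm (L2_norm M (\<lambda>x. h x - T g x)) \<le> ?b n" by simp
        qed
        show "?b \<longlonglongrightarrow> 0"
          using tendsto_add_zero[OF lim tendsto_mult_right_zero[OF k_g]] by (simp add: k_def)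
      qed
      then show ?thesis
        by (simp add: LIMSEQ_const_iff L2_eq_iff_norm_diff h T_L2)
    qed
    \<comment> \<open>\<open>T h\<close> is \<open>c * g\<close> by the definition of
      \<open>g\<close>, and \<open>h\<close> agrees with \<open>T g\<close> almost everywhere, so
      \<open>T\<close> gives both the same value at every point. Hence (T - \<mu>) (T + \<mu>) g =
      0, which the case distinction on \<open>v\<close> exploits.\<close>
    have TTg: "T (T g) t = c * g t" if "t \<in> space M" for t
      using T_cong[OF hTg h T_L2[OF g] that] \<open>c \<noteq> 0\<close> by (simp add: g_def)
    define v where "v x = T g x + of_real \<mu> * g x" for x
    have vW: "v \<in> W" unfolding v_def by (intro W_add W_T W_scale gW)
    show ?thesis
    proof (cases "L2_norm M v = 0")
      case False
      have "L2_eq M (T v) (\<lambda>x. of_real \<mu> * v x)"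
        unfolding v_def
        by (intro L2_eqI) (simp add: T_add T_scale L2_scale T_L2 TTg c_def algebra_simps power2_eq_square)
      with False vW that show ?thesis unfolding W_def by blast
    next
      case True
      then have "AE x in M. v x = 0" using L2_norm_eq_0_iff[OF W_L2[OF vW]] by (simp add: L2_eq_def)
      then have "L2_eq M (T g) (\<lambda>x. - of_real \<mu> * g x)"
        unfolding L2_eq_def by eventually_elim (simp add: v_def add_eq_0_iff)
      with norm_g gW that show ?thesis unfolding W_def by fastforce
    qed
  qed
qed

end

section \<open>The eigenbasis and the absolute value\<close>

lemma L2_orthonormal_insert:
  assumes "L2_orthonormal M E" "v \<in> L2 M" "L2_norm M v = 1" "\<And>e. e \<in> E \<Longrightarrow> L2_inner M v e = 0"
  shows "L2_orthonormal M (insert v E)"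
proof -
  have "L2_inner M v v = 1" using assms(3) by (simp add: L2_inner_self)
  moreover have "L2_inner M e v = 0" if "e \<in> E" for e
    using assms(4)[OF that] L2_inner_commute[of M e v] by simp
  ultimately show ?thesis
    using assms by (auto simp: L2_orthonormal_def)
qed

context compact_hermitian_kernel
begin

text \<open>Reading the eigenvalue off as a Rayleigh quotient gives a total, real-valued function
  without choosing a scalar for each vector; for a unit eigenvector of a symmetric operator it is
  the eigenvalue.\<close>

definition eigenvalue :: "('a \<Rightarrow> complex) \<Rightarrow> real" where
  "eigenvalue e = Re (L2_inner M (T e) e)"

text \<open>Zorn's lemma yields a maximal orthonormal set of eigenvectors. If some nonzero
  \<open>f\<close> were orthogonal to it, its orthogonal complement would contain a further
  eigenvector, possibly for the eigenvalue 0, and the set could be enlarged.\<close>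

theorem eigenbasis_exists:
  obtains E where "L2_orthonormal_basis M E"
    "\<And>e. e \<in> E \<Longrightarrow> L2_eq M (T e) (\<lambda>x. of_real (eigenvalue e) * e x)"
proof -
  define \<A> where "\<A> = {E. L2_orthonormal M E \<and> (\<forall>e\<in>E. \<exists>c. L2_eq M (T e) (\<lambda>x. c * e x))}"
  have "\<exists>E\<in>\<A>. \<forall>X\<in>\<A>. E \<subseteq> X \<longrightarrow> X = E"
  proof (rule subset_Zorn')
    fix C assume C: "subset.chain \<A> C"
    have "L2_orthonormal M (\<Union>C)"
      unfolding L2_orthonormal_def
    proof (intro conjI ballI)
      show "\<Union>C \<subseteq> L2 M"
        using C by (auto simp: subset.chain_def \<A>_def L2_orthonormal_def)
      fix e e' assume "e \<in> \<Union>C" "e' \<in> \<Union>C"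
      then obtain X Y where "X \<in> C" "Y \<in> C" "e \<in> X" "e' \<in> Y" by blast
      moreover then have "X \<subseteq> Y \<or> Y \<subseteq> X" using C by (auto simp: subset.chain_def)
      ultimately obtain Z where "Z \<in> C" "e \<in> Z" "e' \<in> Z" by blast
      moreover have "L2_orthonormal M Z"
        using \<open>Z \<in> C\<close> C by (auto simp: subset.chain_def \<A>_def)
      ultimately show "L2_inner M e e' = (if e = e' then 1 else 0)"
        by (simp add: L2_orthonormal_def)
    qed
    then show "\<Union>C \<in> \<A>"
      using C by (auto simp: subset.chain_def \<A>_def)
  qed
  then obtain E where "E \<in> \<A>" and max: "\<And>X. X \<in> \<A> \<Longrightarrow> E \<subseteq> X \<Longrightarrow> X = E"
    by blast
  then have E: "L2_orthonormal M E" "\<And>e. e \<in> E \<Longrightarrow> \<exists>c. L2_eq M (T e) (\<lambda>x. c * e x)"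
    by (simp_all add: \<A>_def)
  have E_L2: "E \<subseteq> L2 M" using E(1) by (simp add: L2_orthonormal_def)
  have "L2_eq M f (\<lambda>_. 0)" if f: "f \<in> L2 M" "\<forall>e\<in>E. L2_inner M f e = 0" for f
  proof (rule ccontr)
    assume "\<not> L2_eq M f (\<lambda>_. 0)"
    then have "L2_norm M f \<noteq> 0" using L2_norm_eq_0_iff[OF f(1)] by simp
    then obtain v c where v: "v \<in> L2 M" "\<And>e. e \<in> E \<Longrightarrow> L2_inner M v e = 0" "L2_norm M v \<noteq> 0"
        "L2_eq M (T v) (\<lambda>x. c * v x)"
      using eigenvector_exists[OF E_L2 E(2) f(1)] f(2) by metis
    define w where "w x = complex_of_real (inverse (L2_norm M v)) * v x" for x
    have w: "w \<in> L2 M" "L2_norm M w = 1" "\<And>e. e \<in> E \<Longrightarrow> L2_inner M w e = 0"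
      using v unfolding w_def L2_norm_scale L2_inner_scale_left
      by (auto intro!: L2_scale simp: norm_inverse)
    have "L2_eq M (T w) (\<lambda>x. of_real (inverse (L2_norm M v)) * T v x)"
      unfolding w_def by (intro L2_eqI T_scale v)
    then have "L2_eq M (T w) (\<lambda>x. c * w x)"
      using v(4) unfolding L2_eq_def w_def by (auto elim!: AE_mp)
    then have "insert w E \<in> \<A>"
      using L2_orthonormal_insert[OF E(1) w] E(2) by (auto simp: \<A>_def)
    then have "w \<in> E" using max[of "insert w E"] by blast
    then have "L2_inner M w w = 0" by (rule w(3))
    then show False using w(2) by (simp add: L2_inner_self)
  qed
  then have "L2_orthonormal_basis M E"
    using E(1) by (auto simp: L2_orthonormal_basis_def L2_orthonormal_def)
  moreover have "L2_eq M (T e) (\<lambda>x. of_real (eigenvalue e) * e x)" if e: "e \<in> E" for e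
  proof -
    obtain c where c: "L2_eq M (T e) (\<lambda>x. c * e x)" using E(2)[OF e] by blast
    have eL: "e \<in> L2 M" using e E_L2 by blast
    have "L2_inner M (T e) e = L2_inner M (\<lambda>x. c * e x) e"
      by (intro L2_inner_cong_left c T_L2 L2_scale eL)
    also have "\<dots> = c"
      using E(1) e by (simp add: L2_inner_scale_left L2_orthonormal_def)
    finally have *: "L2_inner M (T e) e = c" .
    have "cnj c = c"
      using T_symmetric[OF eL eL] L2_inner_commute[of M e "T e"] * by simp
    then have "c = of_real (eigenvalue e)"
      by (simp add: eigenvalue_def * complex_eq_iff)
    with c show ?thesis by simp
  qed
  ultimately show thesis using that by blast
qed

end

text \<open>Allowing \<open>b n\<close> to be the zero function treats finite and infinite families
  of eigenvectors by one series over the natural numbers.\<close>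

locale spectral_sequence = compact_hermitian_kernel +
  fixes b :: "nat \<Rightarrow> 'a \<Rightarrow> complex" and l :: "nat \<Rightarrow> real"
  assumes b_L2: "\<And>n. b n \<in> L2 M"
    and b_orthogonal: "\<And>i j. i \<noteq> j \<Longrightarrow> L2_inner M (b i) (b j) = 0"
    and b_unit_or_zero: "\<And>n. L2_inner M (b n) (b n) = 1 \<or> b n = (\<lambda>_. 0)"
    and T_b: "\<And>n. L2_eq M (T (b n)) (\<lambda>x. of_real (l n) * b n x)"
begin

text \<open>Zero members contribute nothing. On the remaining indices \<open>b\<close> is injective,
  since a repeated unit vector would be orthogonal to itself, so Bessel applies to the image
  set.\<close>

lemma b_bessel:
  assumes "f \<in> L2 M" "finite I"
  shows "(\<Sum>n\<in>I. (cmod (L2_inner M f (b n)))\<^sup>2) \<le> (L2_norm M f)\<^sup>2"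
proof -
  define J where "J = {n \<in> I. b n \<noteq> (\<lambda>_. 0)}"
  have inj: "inj_on b J"
  proof (rule inj_onI, rule ccontr)
    fix i j assume "i \<in> J" "j \<in> J" "b i = b j" "i \<noteq> j"
    then show False
      using b_orthogonal[of i j] b_unit_or_zero[of i] by (simp add: J_def)
  qed
  have "L2_orthonormal M (b ` J)"
    unfolding L2_orthonormal_def
    using b_L2 b_orthogonal b_unit_or_zero by (auto simp: J_def) metis
  moreover have "finite J" using assms(2) by (simp add: J_def)
  ultimately have "(\<Sum>n\<in>J. (cmod (L2_inner M f (b n)))\<^sup>2) \<le> (L2_norm M f)\<^sup>2"
    using L2_bessel[OF _ _ assms(1), of "b ` J"] by (simp add: sum.reindex[OF inj])
  moreover have "(\<Sum>n\<in>I. (cmod (L2_inner M f (b n)))\<^sup>2) = (\<Sum>n\<in>J. (cmod (L2_inner M f (b n)))\<^sup>2)"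
    by (rule sum.mono_neutral_right) (use assms in \<open>auto simp: J_def\<close>)
  ultimately show ?thesis by simp
qed

text \<open>The bound depends neither on the point \<open>t\<close> nor on \<open>I\<close>. It
  therefore gives pointwise absolute convergence of the spectral series and, multiplied by |g|, a
  dominating function for its partial sums.\<close>

lemma b_sum_bound:
  assumes f: "f \<in> L2 M" and t: "t \<in> space M" and I: "finite I"
  shows "(\<Sum>n\<in>I. cmod (L2_inner M f (b n) * T (b n) t)) \<le> \<kappa> * sqrt_mass * L2_norm M f"
proof -
  let ?k = "\<lambda>u. cnj (K t u)"
  have T: "T (b n) t = cnj (L2_inner M ?k (b n))" for n
    unfolding T_inner[OF b_L2 t] by (rule L2_inner_commute)
  have "(\<Sum>n\<in>I. cmod (L2_inner M f (b n) * T (b n) t))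
      = (\<Sum>n\<in>I. \<bar>cmod (L2_inner M f (b n))\<bar> * \<bar>cmod (L2_inner M ?k (b n))\<bar>)"
    by (simp add: T norm_mult)
  also have "\<dots> \<le> L2_set (\<lambda>n. cmod (L2_inner M f (b n))) I * L2_set (\<lambda>n. cmod (L2_inner M ?k (b n))) I"
    by (rule L2_set_mult_ineq)
  also have "\<dots> \<le> L2_norm M f * L2_norm M ?k"
    unfolding L2_set_def
    by (intro mult_mono real_le_lsqrt b_bessel f row_L2 t I) (auto intro: sum_nonneg)
  also have "\<dots> \<le> L2_norm M f * (\<kappa> * sqrt_mass)"
    by (intro mult_left_mono row_norm t) simp
  finally show ?thesis by (simp add: mult.commute)
qed

text \<open>For \<open>w = 1\<close> this is \<open>T\<close>, and for \<open>w = sgn l\<close> it is \<open>|T|\<close>.\<close>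

definition spectral_op :: "(nat \<Rightarrow> real) \<Rightarrow> ('a \<Rightarrow> complex) \<Rightarrow> 'a \<Rightarrow> complex" where
  "spectral_op w f t = (\<Sum>n. of_real (w n) * (L2_inner M f (b n) * T (b n) t))"

context
  fixes w :: "nat \<Rightarrow> real"
  assumes w: "\<And>n. \<bar>w n\<bar> \<le> 1"
begin

lemma spectral_op_partial_bound:
  assumes "f \<in> L2 M" "t \<in> space M"
  shows "(\<Sum>n<N. norm (of_real (w n) * (L2_inner M f (b n) * T (b n) t))) \<le> \<kappa> * sqrt_mass * L2_norm M f"
proof -
  have "(\<Sum>n<N. norm (of_real (w n) * (L2_inner M f (b n) * T (b n) t)))
      \<le> (\<Sum>n<N. cmod (L2_inner M f (b n) * T (b n) t))"
    using w by (intro sum_mono) (simp add: norm_mult mult_left_le_one_le)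
  also have "\<dots> \<le> \<kappa> * sqrt_mass * L2_norm M f"
    by (rule b_sum_bound[OF assms]) simp
  finally show ?thesis .
qed

lemma spectral_op_summable:
  assumes "f \<in> L2 M" "t \<in> space M"
  shows "summable (\<lambda>n. of_real (w n) * (L2_inner M f (b n) * T (b n) t))"
proof (rule summable_norm_cancel, rule summableI_nonneg_bounded)
  fix N show "(\<Sum>n<N. norm (of_real (w n) * (L2_inner M f (b n) * T (b n) t))) \<le> \<kappa> * sqrt_mass * L2_norm M f"
    by (rule spectral_op_partial_bound[OF assms])
qed simp

lemma spectral_op_bound:
  assumes "f \<in> L2 M" "t \<in> space M"
  shows "cmod (spectral_op w f t) \<le> \<kappa> * sqrt_mass * L2_norm M f"
proof (rule LIMSEQ_le_const2)
  show "(\<lambda>N. cmod (\<Sum>n<N. of_real (w n) * (L2_inner M f (b n) * T (b n) t))) \<longlonglongrightarrow> cmod (spectral_op w f t)"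
    unfolding spectral_op_def by (intro tendsto_norm summable_LIMSEQ spectral_op_summable assms)
  show "\<exists>N. \<forall>n\<ge>N. cmod (\<Sum>n<n. of_real (w n) * (L2_inner M f (b n) * T (b n) t)) \<le> \<kappa> * sqrt_mass * L2_norm M f"
    using order_trans[OF norm_sum spectral_op_partial_bound[OF assms]] by blast
qed

lemma spectral_op_measurable [measurable]: "spectral_op w f \<in> borel_measurable M"
proof -
  have [measurable]: "T (b n) \<in> borel_measurable M" for n
    by (rule T_measurable[OF b_L2])
  show ?thesis unfolding spectral_op_def[abs_def] by measurable
qed

lemma spectral_op_L2: "f \<in> L2 M \<Longrightarrow> spectral_op w f \<in> L2 M"
  by (rule L2_bounded[OF spectral_op_measurable spectral_op_bound])

lemma spectral_op_add:
  assumes "f \<in> L2 M" "g \<in> L2 M" "t \<in> space M"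
  shows "spectral_op w (\<lambda>x. f x + g x) t = spectral_op w f t + spectral_op w g t"
  unfolding spectral_op_def using assms
  by (subst suminf_add[OF spectral_op_summable spectral_op_summable])
     (auto simp: L2_inner_add_left[OF _ _ b_L2] algebra_simps)

lemma spectral_op_scale:
  assumes "f \<in> L2 M" "t \<in> space M"
  shows "spectral_op w (\<lambda>x. c * f x) t = c * spectral_op w f t"
  unfolding spectral_op_def using assms
  by (subst suminf_mult[OF spectral_op_summable, symmetric]) (auto simp: L2_inner_scale_left algebra_simps)

lemma spectral_op_cong:
  assumes "L2_eq M f g" "f \<in> L2 M" "g \<in> L2 M"
  shows "spectral_op w f = spectral_op w g"
  unfolding spectral_op_def using L2_inner_cong_left[OF assms b_L2] by simp

lemma spectral_op_bounded_linear: "L2_bounded_linear M (spectral_op w)"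
  unfolding L2_bounded_linear_def
proof (intro conjI ballI allI impI exI)
  fix f assume f: "f \<in> L2 M"
  have "L2_norm M (spectral_op w f) \<le> (\<kappa> * sqrt_mass * L2_norm M f) * sqrt (measure M (space M))"
    by (rule L2_norm_bounded) (use f spectral_op_bound \<kappa>_nonneg sqrt_mass_nonneg in auto)
  then show "L2_norm M (spectral_op w f) \<le> (\<kappa> * sqrt_mass\<^sup>2) * L2_norm M f"
    by (simp add: sqrt_mass_def[symmetric] power2_eq_square mult_ac)
qed (auto intro!: L2_eqI spectral_op_L2 spectral_op_add spectral_op_scale simp: spectral_op_cong)

lemma T_b_inner:
  assumes "g \<in> L2 M"
  shows "L2_inner M (T (b n)) g = of_real (l n) * L2_inner M (b n) g"
proof -
  have "L2_inner M (T (b n)) g = L2_inner M (\<lambda>x. of_real (l n) * b n x) g"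
    by (intro L2_inner_cong_left T_b T_L2 L2_scale b_L2 assms)
  then show ?thesis by (simp add: L2_inner_scale_left)
qed

text \<open>Dominated convergence with a constant multiple of |g|, which is integrable because the
  measure is finite. The series of \<open>spectral_op\<close> is only known to converge pointwise,
  and this is what lets inner products be taken term by term.\<close>

lemma spectral_op_inner_sums:
  assumes f: "f \<in> L2 M" and g: "g \<in> L2 M"
  shows "(\<lambda>n. of_real (w n * l n) * (L2_inner M f (b n) * L2_inner M (b n) g)) sums L2_inner M (spectral_op w f) g"
proof -
  let ?s = "\<lambda>N t. \<Sum>n<N. of_real (w n) * (L2_inner M f (b n) * T (b n) t)"
  have [measurable]: "g \<in> borel_measurable M" "T (b n) \<in> borel_measurable M" for n
    using g T_measurable[OF b_L2] by auto
  have "(\<lambda>N. LINT t|M. ?s N t * cnj (g t)) \<longlonglongrightarrow> (LINT t|M. spectral_op w f t * cnj (g t))"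
  proof (rule integral_dominated_convergence)
    show "integrable M (\<lambda>t. (\<kappa> * sqrt_mass * L2_norm M f) * cmod (g t))"
      using L2_integrable[OF g] by (intro integrable_mult_right integrable_norm)
    show "AE t in M. (\<lambda>N. ?s N t * cnj (g t)) \<longlonglongrightarrow> spectral_op w f t * cnj (g t)"
      unfolding spectral_op_def by (intro AE_I2 tendsto_mult_right summable_LIMSEQ spectral_op_summable f)
    show "AE t in M. norm (?s N t * cnj (g t)) \<le> (\<kappa> * sqrt_mass * L2_norm M f) * cmod (g t)" for N
      using order_trans[OF norm_sum spectral_op_partial_bound[OF f]]
      by (intro AE_I2) (simp only: norm_mult complex_mod_cnj, intro mult_right_mono, auto)
  qed measurable
  moreover have "(LINT t|M. ?s N t * cnj (g t))
      = (\<Sum>n<N. of_real (w n * l n) * (L2_inner M f (b n) * L2_inner M (b n) g))" for N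
  proof -
    have "(LINT t|M. ?s N t * cnj (g t)) = L2_inner M (?s N) g"
      by (simp add: L2_inner_def)
    also have "\<dots> = (\<Sum>n<N. L2_inner M (\<lambda>t. of_real (w n) * (L2_inner M f (b n) * T (b n) t)) g)"
      by (intro L2_inner_sum_left L2_scale T_L2 b_L2 g)
    finally show ?thesis
      by (simp add: L2_inner_scale_left T_b_inner[OF g]) (simp add: mult_ac)
  qed
  ultimately show ?thesis
    unfolding sums_def L2_inner_def[of M "spectral_op w f"] by simp
qed

lemma spectral_op_inner_b:
  assumes f: "f \<in> L2 M"
  shows "L2_inner M (spectral_op w f) (b n) = of_real (w n * l n) * L2_inner M f (b n)"
proof -
  let ?a = "\<lambda>i. of_real (w i * l i) * (L2_inner M f (b i) * L2_inner M (b i) (b n))"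
  have "?a sums (\<Sum>i\<in>{n}. ?a i)"
    by (rule sums_finite) (simp_all add: b_orthogonal)
  from sums_unique2[OF spectral_op_inner_sums[OF f b_L2] this]
  have "L2_inner M (spectral_op w f) (b n) = ?a n" by simp
  \<comment> \<open>Orthogonality has left a single term; if \<open>b n\<close> is the zero
    function, both sides are 0.\<close>
  then show ?thesis using b_unit_or_zero[of n] by auto
qed

lemma spectral_op_inner_orthogonal:
  assumes "f \<in> L2 M" "g \<in> L2 M" "\<And>n. L2_inner M (b n) g = 0"
  shows "L2_inner M (spectral_op w f) g = 0"
  using sums_unique2[OF sums_zero, of "L2_inner M (spectral_op w f) g"] spectral_op_inner_sums[OF assms(1,2)]
  by (simp add: assms(3))

lemma spectral_op_positive:
  assumes "\<And>n. 0 \<le> w n * l n"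
  shows "L2_positive M (spectral_op w)"
  unfolding L2_positive_def
proof (intro conjI ballI spectral_op_bounded_linear)
  fix f assume f: "f \<in> L2 M"
  let ?z = "L2_inner M (spectral_op w f) f"
  let ?x = "\<lambda>n. (w n * l n) * (cmod (L2_inner M f (b n)))\<^sup>2"
  have "L2_inner M f (b n) * L2_inner M (b n) f = of_real ((cmod (L2_inner M f (b n)))\<^sup>2)" for n
    unfolding complex_norm_square L2_inner_commute[of M "b n" f] ..
  then have sums: "(\<lambda>n. complex_of_real (?x n)) sums ?z"
    using spectral_op_inner_sums[OF f f] by simp
  have "0 \<le> Re ?z"
    by (rule sums_le[OF _ sums_zero sums_Re[OF sums]]) (simp add: assms)
  moreover have "Im ?z = 0"
    using sums_unique2[OF sums_zero, of "Im ?z"] sums_Im[OF sums] by simp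
  ultimately show "?z \<in> \<real>\<^sub>\<ge>\<^sub>0" by (simp add: complex_nonneg_Reals_iff)
qed

end

end

section \<open>From bounded diagonal sums to the trace class\<close>

context compact_hermitian_kernel
begin

text \<open>Applied to finite parts of the eigenbasis, the hypothesis bounds the sums of the
  absolute eigenvalues, which are the diagonal entries of |T|. The remaining work is to realize |T|
  as an operator on functions and to verify its square.\<close>

theorem trace_class_if_eigenvalue_sums_bounded:
  assumes nuclear: "\<And>F. finite F \<Longrightarrow> L2_orthonormal M F \<Longrightarrow> (\<Sum>e\<in>F. cmod (L2_inner M (T e) e)) \<le> C"
  shows "L2_trace_class M T"
proof -
  obtain E where basis: "L2_orthonormal_basis M E"
    and T_E: "\<And>e. e \<in> E \<Longrightarrow> L2_eq M (T e) (\<lambda>x. of_real (eigenvalue e) * e x)"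
    using eigenbasis_exists by blast
  then have E: "L2_orthonormal M E" by (simp add: L2_orthonormal_basis_def L2_orthonormal_def)
  then have E_L2: "e \<in> L2 M" if "e \<in> E" for e using that by (auto simp: L2_orthonormal_def)
  have T_E_inner: "L2_inner M (T e) g = of_real (eigenvalue e) * L2_inner M e g"
    if "e \<in> E" "g \<in> L2 M" for e g
  proof -
    have "L2_inner M (T e) g = L2_inner M (\<lambda>x. of_real (eigenvalue e) * e x) g"
      by (intro L2_inner_cong_left T_E T_L2 L2_scale E_L2 that)
    then show ?thesis by (simp add: L2_inner_scale_left)
  qed
  have summable: "(\<lambda>e. \<bar>eigenvalue e\<bar>) summable_on E"
  proof (rule nonneg_bdd_above_summable_on)
    show "bdd_above (sum (\<lambda>e. \<bar>eigenvalue e\<bar>) ` {F. F \<subseteq> E \<and> finite F})"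
    proof (rule bdd_aboveI2)
      fix F assume "F \<in> {F. F \<subseteq> E \<and> finite F}"
      then have F: "F \<subseteq> E" "finite F" by auto
      have "(\<Sum>e\<in>F. \<bar>eigenvalue e\<bar>) \<le> (\<Sum>e\<in>F. cmod (L2_inner M (T e) e))"
        unfolding eigenvalue_def by (intro sum_mono abs_Re_le_cmod)
      then show "(\<Sum>e\<in>F. \<bar>eigenvalue e\<bar>) \<le> C"
        using nuclear[OF F(2) L2_orthonormal_mono[OF E F(1)]] by simp
    qed
  qed simp
  \<comment> \<open>A summable family has countably many nonzero members. The rest of the basis, of
    whatever cardinality, lies in the null space of \<open>T\<close>.\<close>
  define E0 where "E0 = {e \<in> E. eigenvalue e \<noteq> 0}"
  have "countable E0"
    using summable_countable_real[OF summable] by (simp add: E0_def)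
  \<comment> \<open>If \<open>E0\<close> is finite, \<open>to_nat_on\<close> covers only an initial
    segment of the natural numbers; all other indices receive the zero function.\<close>
  define b where "b n = (if n \<in> to_nat_on E0 ` E0 then from_nat_into E0 n else (\<lambda>_. 0))" for n
  define l where "l n = eigenvalue (b n)" for n
  have b_cases: "(b n \<in> E0 \<and> n = to_nat_on E0 (b n)) \<or> b n = (\<lambda>_. 0)" for n
    using \<open>countable E0\<close> by (auto simp: b_def)
  have b_surj: "\<exists>n. b n = e" if "e \<in> E0" for e
    by (rule exI[of _ "to_nat_on E0 e"]) (use that \<open>countable E0\<close> in \<open>auto simp: b_def\<close>)
  interpret spectral_sequence M K \<kappa> T b l
  proof
    fix n i j :: nat
    show bL: "b n \<in> L2 M" using b_cases[of n] E_L2 by (auto simp: E0_def L2_zero)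
    show "L2_inner M (b i) (b j) = 0" if "i \<noteq> j"
      using b_cases[of i] b_cases[of j] that E by (auto simp: E0_def L2_orthonormal_def)
    show "L2_inner M (b n) (b n) = 1 \<or> b n = (\<lambda>_. 0)"
      using b_cases[of n] E by (auto simp: E0_def L2_orthonormal_def)
    show "L2_eq M (T (b n)) (\<lambda>x. of_real (l n) * b n x)"
    proof (cases "b n = (\<lambda>_. 0)")
      case True
      then show ?thesis using bL by (intro L2_eqI) (simp add: T_eq)
    next
      case False
      then show ?thesis using b_cases[of n] T_E by (auto simp: l_def E0_def)
    qed
  qed
  have b_null: "L2_inner M (b n) e = 0" if "e \<in> E" "e \<notin> E0" for n e
    using b_cases[of n] E that by (auto simp: E0_def L2_orthonormal_def)
  \<comment> \<open>Both sides have the same coefficient against every vector of \<open>E\<close>: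
    on \<open>E0\<close> by the computation for \<open>b\<close>, off \<open>E0\<close> because both
    coefficients vanish. Maximality of \<open>E\<close> then gives equality almost
    everywhere.\<close>
  have T_expand: "L2_eq M (T f) (spectral_op (\<lambda>_. 1) f)" if f: "f \<in> L2 M" for f
  proof -
    have D1: "spectral_op (\<lambda>_. 1) f \<in> L2 M" by (rule spectral_op_L2[OF _ f]) simp
    let ?h = "\<lambda>x. T f x - spectral_op (\<lambda>_. 1) f x"
    have "L2_inner M ?h e = 0" if e: "e \<in> E" for e
    proof -
      have "L2_inner M (T f) e = cnj (L2_inner M (T e) f)"
        using T_symmetric[OF f E_L2[OF e]] L2_inner_commute by metis
      then have Tfe: "L2_inner M (T f) e = of_real (eigenvalue e) * L2_inner M f e"
        using T_E_inner[OF e f] L2_inner_commute[of M f e] by simp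
      have "L2_inner M (spectral_op (\<lambda>_. 1) f) e = of_real (eigenvalue e) * L2_inner M f e"
      proof (cases "e \<in> E0")
        case True
        then obtain n where "b n = e" using b_surj by blast
        then show ?thesis using spectral_op_inner_b[of "\<lambda>_. 1", OF _ f, of n] by (auto simp: l_def)
      next
        case False
        then have "L2_inner M (spectral_op (\<lambda>_. 1) f) e = 0"
          using e by (intro spectral_op_inner_orthogonal f E_L2 b_null) auto
        then show ?thesis using False e by (simp add: E0_def)
      qed
      with Tfe show ?thesis by (simp add: L2_inner_diff_left T_L2 f D1 E_L2 e)
    qed
    then have "L2_eq M ?h (\<lambda>_. 0)"
      using basis L2_diff[OF T_L2[OF f] D1] by (simp add: L2_orthonormal_basis_def)
    then show ?thesis by (simp add: L2_eq_def)
  qed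
  define w where "w n = sgn (l n)" for n
  have w: "\<bar>w n\<bar> \<le> 1" for n by (simp add: w_def abs_sgn_eq)
  have wl: "w n * l n = \<bar>l n\<bar>" "w n * \<bar>l n\<bar> = l n" for n
    by (simp_all add: w_def mult.commute[of "sgn _"] abs_sgn[symmetric] abs_mult_sgn)
  have square: "L2_eq M (spectral_op w (spectral_op w f)) (T (T f))" if f: "f \<in> L2 M" for f
  proof -
    have "L2_inner M (T f) (b n) = of_real (l n) * L2_inner M f (b n)" for n
      using L2_inner_cong_left[OF T_expand[OF f] T_L2[OF f] spectral_op_L2[OF _ f] b_L2]
        spectral_op_inner_b[of "\<lambda>_. 1", OF _ f] by simp
    moreover have "of_real (w n) * L2_inner M (spectral_op w f) (b n) = of_real (l n) * L2_inner M f (b n)" for n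
      unfolding spectral_op_inner_b[OF w f] wl mult.assoc[symmetric] of_real_mult[symmetric] ..
    \<comment> \<open>A spectral series sees its argument only through the coefficients against
      \<open>b\<close>. Since sgn(l) |l| = l, the two series agree term by term, hence as functions;
      only the return to \<open>T (T f)\<close> is almost everywhere.\<close>
    ultimately have "spectral_op w (spectral_op w f) = spectral_op (\<lambda>_. 1) (T f)"
      unfolding spectral_op_def[of w "spectral_op w f"] spectral_op_def[of "\<lambda>_. 1" "T f"] by (simp add: mult.assoc[symmetric])
    then show ?thesis using L2_eq_sym[OF T_expand[OF T_L2[OF f]]] by simp
  qed
  have "L2_abs M T (spectral_op w)"
    unfolding L2_abs_def
    using spectral_op_positive[OF w] wl T_adjoint square by auto
  moreover have "(\<lambda>e. L2_inner M (spectral_op w e) e) summable_on E"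
  proof -
    have trace: "L2_inner M (spectral_op w e) e = of_real \<bar>eigenvalue e\<bar>" if e: "e \<in> E" for e
    proof (cases "e \<in> E0")
      case True
      then obtain n where n: "b n = e" using b_surj by blast
      then show ?thesis
        using spectral_op_inner_b[of w, OF w E_L2[OF e], of n] E e
        unfolding wl by (simp add: l_def L2_orthonormal_def)
    next
      case False
      then have "L2_inner M (spectral_op w e) e = 0"
        by (intro spectral_op_inner_orthogonal[of w, OF w E_L2[OF e] E_L2[OF e]] b_null[OF e])
      then show ?thesis using False e by (simp add: E0_def)
    qed
    show ?thesis
      by (subst summable_on_cong[OF trace]) (simp_all add: summable summable_on_of_real)
  qed
  ultimately show ?thesis
    unfolding L2_trace_class_def using T_bounded_linear basis by blast
qed

end

section \<open>Nuclear kernels\<close>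

definition kernel_op :: "'a measure \<Rightarrow> ('a \<Rightarrow> 'a \<Rightarrow> real) \<Rightarrow> ('a \<Rightarrow> complex) \<Rightarrow> 'a \<Rightarrow> complex" where
  "kernel_op M k f t = (LINT u|M. of_real (k t u) * f u)"

definition kernel_bound :: "'a measure \<Rightarrow> real \<Rightarrow> ('a \<Rightarrow> 'a \<Rightarrow> real) \<Rightarrow> bool" where
  "kernel_bound M \<kappa> k \<longleftrightarrow>
     (\<lambda>(t, u). k t u) \<in> borel_measurable (M \<Otimes>\<^sub>M M) \<and> 0 \<le> \<kappa> \<and>
     (\<forall>t\<in>space M. \<forall>u\<in>space M. \<bar>k t u\<bar> \<le> \<kappa>)"

text \<open>The best constant \<open>C\<close> is the trace norm when the operator is self-adjoint.\<close>

definition nuclear_kernel :: "'a measure \<Rightarrow> real \<Rightarrow> ('a \<Rightarrow> 'a \<Rightarrow> real) \<Rightarrow> bool" where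
  "nuclear_kernel M C k \<longleftrightarrow> (\<exists>\<kappa>. kernel_bound M \<kappa> k) \<and>
     (\<forall>F. finite F \<longrightarrow> L2_orthonormal M F \<longrightarrow> (\<Sum>e\<in>F. cmod (L2_inner M (kernel_op M k e) e)) \<le> C)"

section \<open>Operations on nuclear kernels\<close>

context finite_measure
begin

lemma kernel_bound_bounded_kernel:
  assumes "kernel_bound M \<kappa> k"
  shows "bounded_kernel M (\<lambda>t u. of_real (k t u)) \<kappa> (kernel_op M k)"
proof
  have [measurable]: "(\<lambda>(t, u). k t u) \<in> borel_measurable (M \<Otimes>\<^sub>M M)"
    using assms by (simp add: kernel_bound_def)
  show "(\<lambda>(t, u). complex_of_real (k t u)) \<in> borel_measurable (M \<Otimes>\<^sub>M M)"
    by measurable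
qed (use assms in \<open>auto simp: kernel_bound_def kernel_op_def\<close>)

lemma kernel_row_integrable:
  assumes "kernel_bound M \<kappa> k" "f \<in> L2 M" "t \<in> space M"
  shows "integrable M (\<lambda>u. of_real (k t u) * f u)"
proof -
  interpret bounded_kernel M "\<lambda>t u. of_real (k t u)" \<kappa> "kernel_op M k"
    by (rule kernel_bound_bounded_kernel[OF assms(1)])
  show ?thesis
    using L2_mult_integrable[OF row_L2[OF assms(3)] assms(2)] by simp
qed

text \<open>An estimate for one unit vector, not for a sum over an orthonormal set. Its purpose is
  the tail of a uniformly convergent series of kernels, tested on a fixed finite set.\<close>

lemma kernel_form_bound:
  assumes "kernel_bound M \<kappa> k" "e \<in> L2 M" "L2_norm M e = 1"
  shows "cmod (L2_inner M (kernel_op M k e) e) \<le> \<kappa> * measure M (space M)"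
proof -
  interpret bounded_kernel M "\<lambda>t u. of_real (k t u)" \<kappa> "kernel_op M k"
    by (rule kernel_bound_bounded_kernel[OF assms(1)])
  have "cmod (L2_inner M (kernel_op M k e) e) \<le> L2_norm M (kernel_op M k e)"
    using L2_Cauchy_Schwarz[OF T_L2[OF assms(2)] assms(2)] assms(3) by simp
  also have "\<dots> \<le> \<kappa> * sqrt_mass\<^sup>2"
    using T_norm[OF assms(2)] assms(3) by simp
  finally show ?thesis by (simp add: sqrt_mass_def)
qed

lemma kernel_form_add:
  assumes "kernel_bound M \<kappa>1 k1" "kernel_bound M \<kappa>2 k2" "e \<in> L2 M"
  shows "L2_inner M (kernel_op M (\<lambda>t u. k1 t u + k2 t u) e) e
    = L2_inner M (kernel_op M k1 e) e + L2_inner M (kernel_op M k2 e) e"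
proof -
  interpret k1: bounded_kernel M "\<lambda>t u. of_real (k1 t u)" \<kappa>1 "kernel_op M k1"
    by (rule kernel_bound_bounded_kernel[OF assms(1)])
  interpret k2: bounded_kernel M "\<lambda>t u. of_real (k2 t u)" \<kappa>2 "kernel_op M k2"
    by (rule kernel_bound_bounded_kernel[OF assms(2)])
  have "L2_inner M (kernel_op M (\<lambda>t u. k1 t u + k2 t u) e) e
      = L2_inner M (\<lambda>t. kernel_op M k1 e t + kernel_op M k2 e t) e"
    unfolding L2_inner_def kernel_op_def of_real_add distrib_right[of "of_real _" "of_real _"]
    by (intro Bochner_Integration.integral_cong refl)
       (simp add: Bochner_Integration.integral_add kernel_row_integrable[OF assms(1,3)] kernel_row_integrable[OF assms(2,3)])
  then show ?thesis
    using k1.T_L2 k2.T_L2 assms(3) by (simp add: L2_inner_add_left)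
qed

lemma kernel_form_scale:
  "L2_inner M (kernel_op M (\<lambda>t u. c * k t u) e) e = of_real c * L2_inner M (kernel_op M k e) e"
  by (simp add: kernel_op_def[abs_def] mult.assoc L2_inner_scale_left)

lemma kernel_form_cong:
  assumes "\<And>t u. t \<in> space M \<Longrightarrow> u \<in> space M \<Longrightarrow> k t u = k' t u"
  shows "L2_inner M (kernel_op M k e) e = L2_inner M (kernel_op M k' e) e"
  unfolding L2_inner_def kernel_op_def
  by (intro Bochner_Integration.integral_cong refl arg_cong2[where f = "(*)"]) (simp add: assms)

lemma kernel_bound_cong:
  assumes "\<And>t u. t \<in> space M \<Longrightarrow> u \<in> space M \<Longrightarrow> k t u = k' t u" "kernel_bound M \<kappa> k"
  shows "kernel_bound M \<kappa> k'"
proof -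
  have "(\<lambda>(t, u). k t u) \<in> borel_measurable (M \<Otimes>\<^sub>M M) \<longleftrightarrow> (\<lambda>(t, u). k' t u) \<in> borel_measurable (M \<Otimes>\<^sub>M M)"
    by (rule measurable_cong) (auto simp: space_pair_measure assms(1))
  then show ?thesis using assms by (auto simp: kernel_bound_def)
qed

lemma kernel_bound_add:
  assumes "kernel_bound M \<kappa>1 k1" "kernel_bound M \<kappa>2 k2"
  shows "kernel_bound M (\<kappa>1 + \<kappa>2) (\<lambda>t u. k1 t u + k2 t u)"
proof -
  have [measurable]: "(\<lambda>(t, u). k1 t u) \<in> borel_measurable (M \<Otimes>\<^sub>M M)"
      "(\<lambda>(t, u). k2 t u) \<in> borel_measurable (M \<Otimes>\<^sub>M M)"
    using assms by (simp_all add: kernel_bound_def)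
  have "(\<lambda>(t, u). k1 t u + k2 t u) \<in> borel_measurable (M \<Otimes>\<^sub>M M)" by measurable
  moreover have "\<bar>k1 t u + k2 t u\<bar> \<le> \<kappa>1 + \<kappa>2" if "t \<in> space M" "u \<in> space M" for t u
    using assms that abs_triangle_ineq[of "k1 t u" "k2 t u"] unfolding kernel_bound_def by fastforce
  ultimately show ?thesis using assms by (auto simp: kernel_bound_def)
qed

lemma kernel_bound_scale:
  assumes "kernel_bound M \<kappa> k"
  shows "kernel_bound M (\<bar>c\<bar> * \<kappa>) (\<lambda>t u. c * k t u)"
proof -
  have [measurable]: "(\<lambda>(t, u). k t u) \<in> borel_measurable (M \<Otimes>\<^sub>M M)"
    using assms by (simp add: kernel_bound_def)
  have "(\<lambda>(t, u). c * k t u) \<in> borel_measurable (M \<Otimes>\<^sub>M M)" by measurable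
  then show ?thesis using assms by (auto simp: kernel_bound_def abs_mult intro!: mult_left_mono)
qed

lemma nuclear_kernelD:
  assumes "nuclear_kernel M C k"
  shows "\<exists>\<kappa>. kernel_bound M \<kappa> k"
    "finite F \<Longrightarrow> L2_orthonormal M F \<Longrightarrow> (\<Sum>e\<in>F. cmod (L2_inner M (kernel_op M k e) e)) \<le> C"
  using assms by (simp_all add: nuclear_kernel_def)

lemma nuclear_kernel_cong:
  assumes "nuclear_kernel M C k" "\<And>t u. t \<in> space M \<Longrightarrow> u \<in> space M \<Longrightarrow> k t u = k' t u"
  shows "nuclear_kernel M C k'"
  using assms(1) kernel_form_cong[of k k', OF assms(2)] kernel_bound_cong[of k k', OF assms(2)]
  unfolding nuclear_kernel_def by fastforce

lemma nuclear_kernel_add: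
  assumes "nuclear_kernel M C1 k1" "nuclear_kernel M C2 k2"
  shows "nuclear_kernel M (C1 + C2) (\<lambda>t u. k1 t u + k2 t u)"
  unfolding nuclear_kernel_def
proof (intro conjI allI impI)
  obtain \<kappa>1 \<kappa>2 where b: "kernel_bound M \<kappa>1 k1" "kernel_bound M \<kappa>2 k2"
    using assms nuclear_kernelD(1) by blast
  then show "\<exists>\<kappa>. kernel_bound M \<kappa> (\<lambda>t u. k1 t u + k2 t u)"
    using kernel_bound_add by blast
  fix F assume F: "finite F" "L2_orthonormal M F"
  have "(\<Sum>e\<in>F. cmod (L2_inner M (kernel_op M (\<lambda>t u. k1 t u + k2 t u) e) e))
     \<le> (\<Sum>e\<in>F. cmod (L2_inner M (kernel_op M k1 e) e) + cmod (L2_inner M (kernel_op M k2 e) e))"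
  proof (rule sum_mono)
    fix e assume "e \<in> F"
    then have "e \<in> L2 M" using F by (auto simp: L2_orthonormal_def)
    then show "cmod (L2_inner M (kernel_op M (\<lambda>t u. k1 t u + k2 t u) e) e)
        \<le> cmod (L2_inner M (kernel_op M k1 e) e) + cmod (L2_inner M (kernel_op M k2 e) e)"
      unfolding kernel_form_add[OF b \<open>e \<in> L2 M\<close>] by (intro norm_triangle_ineq)
  qed
  also have "\<dots> \<le> C1 + C2"
    unfolding sum.distrib by (intro add_mono nuclear_kernelD(2) assms F)
  finally show "(\<Sum>e\<in>F. cmod (L2_inner M (kernel_op M (\<lambda>t u. k1 t u + k2 t u) e) e)) \<le> C1 + C2" .
qed

lemma nuclear_kernel_scale:
  assumes "nuclear_kernel M C k"
  shows "nuclear_kernel M (\<bar>c\<bar> * C) (\<lambda>t u. c * k t u)"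
  unfolding nuclear_kernel_def
proof (intro conjI allI impI)
  show "\<exists>\<kappa>. kernel_bound M \<kappa> (\<lambda>t u. c * k t u)"
    using assms nuclear_kernelD(1) kernel_bound_scale by blast
  fix F assume F: "finite F" "L2_orthonormal M F"
  show "(\<Sum>e\<in>F. cmod (L2_inner M (kernel_op M (\<lambda>t u. c * k t u) e) e)) \<le> \<bar>c\<bar> * C"
    unfolding kernel_form_scale norm_mult norm_of_real sum_distrib_left[symmetric]
    by (intro mult_left_mono nuclear_kernelD(2) assms F) simp
qed

lemma nuclear_kernel_zero: "nuclear_kernel M 0 (\<lambda>_ _. 0)"
  unfolding nuclear_kernel_def kernel_bound_def kernel_op_def[abs_def] by auto

lemma nuclear_kernel_sum:
  assumes "\<And>i. i \<in> I \<Longrightarrow> nuclear_kernel M (C i) (k i)"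
  shows "nuclear_kernel M (\<Sum>i\<in>I. C i) (\<lambda>t u. \<Sum>i\<in>I. k i t u)"
  using assms
  by (induction I rule: infinite_finite_induct) (simp_all add: nuclear_kernel_zero nuclear_kernel_add)

text \<open>The two summable sequences have different tasks: \<open>d\<close> makes the series of
  kernels converge uniformly, and \<open>C\<close> bounds the diagonal sums. For fixed
  \<open>F\<close> the tail contributes at most card F times its supremum times the total mass; this
  tends to 0, so the bounds for the partial sums survive in the limit.\<close>

lemma nuclear_kernel_series:
  assumes nuclear: "\<And>n. nuclear_kernel M (C n) (k n)" and C: "summable C"
    and k: "\<And>n t u. t \<in> space M \<Longrightarrow> u \<in> space M \<Longrightarrow> \<bar>k n t u\<bar> \<le> d n" and d: "summable d"
  shows "nuclear_kernel M (\<Sum>n. C n) (\<lambda>t u. \<Sum>n. k n t u)"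
  unfolding nuclear_kernel_def
proof (intro conjI allI impI)
  let ?k = "\<lambda>t u. \<Sum>n. k n t u"
  have d_nonneg: "0 \<le> d n" if "t \<in> space M" "u \<in> space M" for n t u
    using k[OF that, of n] by linarith
  have summ: "summable (\<lambda>n. k n t u)" "\<bar>?k t u\<bar> \<le> (\<Sum>n. d n)"
      "\<bar>?k t u - (\<Sum>n<N. k n t u)\<bar> \<le> (\<Sum>n. d (n + N))" if tu: "t \<in> space M" "u \<in> space M" for t u N
  proof -
    show s: "summable (\<lambda>n. k n t u)"
      by (rule summable_comparison_test'[OF d, of 0]) (simp add: k[OF tu])
    show "\<bar>?k t u\<bar> \<le> (\<Sum>n. d n)"
      using norm_suminf_le[of "\<lambda>n. k n t u" d] k[OF tu] d by simp
    have "?k t u - (\<Sum>n<N. k n t u) = (\<Sum>n. k (n + N) t u)"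
      using suminf_split_initial_segment[OF s, of N] by simp
    also have "\<bar>\<dots>\<bar> \<le> (\<Sum>n. d (n + N))"
      using norm_suminf_le[of "\<lambda>n. k (n + N) t u" "\<lambda>n. d (n + N)"] k[OF tu] summable_ignore_initial_segment[OF d]
      by simp
    finally show "\<bar>?k t u - (\<Sum>n<N. k n t u)\<bar> \<le> (\<Sum>n. d (n + N))" .
  qed
  have [measurable]: "(\<lambda>(t, u). k n t u) \<in> borel_measurable (M \<Otimes>\<^sub>M M)" for n
    using nuclear_kernelD(1)[OF nuclear[of n]] by (auto simp: kernel_bound_def)
  have meas [measurable]: "(\<lambda>(t, u). ?k t u) \<in> borel_measurable (M \<Otimes>\<^sub>M M)"
    by measurable
  \<comment> \<open>The absolute value covers an empty space, where nothing forces the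
    \<open>d n\<close> to be nonnegative.\<close>
  have "kernel_bound M \<bar>\<Sum>n. d n\<bar> ?k"
    unfolding kernel_bound_def using meas summ(2) by (auto intro: order_trans[OF _ abs_ge_self])
  then show "\<exists>\<kappa>. kernel_bound M \<kappa> ?k" ..
  fix F assume F: "finite F" "L2_orthonormal M F"
  let ?r = "\<lambda>N t u. ?k t u - (\<Sum>n<N. k n t u)"
  have r: "kernel_bound M \<bar>\<Sum>n. d (n + N)\<bar> (?r N)" for N
  proof -
    have "(\<lambda>(t, u). ?r N t u) \<in> borel_measurable (M \<Otimes>\<^sub>M M)" by measurable
    then show ?thesis
      unfolding kernel_bound_def using summ(3)[of _ _ N] by (auto intro: order_trans[OF _ abs_ge_self])
  qed
  have partial: "nuclear_kernel M (\<Sum>n<N. C n) (\<lambda>t u. \<Sum>n<N. k n t u)" for N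
    by (rule nuclear_kernel_sum) (rule nuclear)
  have bound: "(\<Sum>e\<in>F. cmod (L2_inner M (kernel_op M ?k e) e))
      \<le> (\<Sum>n<N. C n) + card F * (\<bar>\<Sum>n. d (n + N)\<bar> * measure M (space M))" for N
  proof -
    obtain \<kappa> where \<kappa>: "kernel_bound M \<kappa> (\<lambda>t u. \<Sum>n<N. k n t u)"
      using nuclear_kernelD(1)[OF partial] by blast
    have "(\<Sum>e\<in>F. cmod (L2_inner M (kernel_op M ?k e) e))
      \<le> (\<Sum>e\<in>F. cmod (L2_inner M (kernel_op M (\<lambda>t u. \<Sum>n<N. k n t u) e) e)
            + \<bar>\<Sum>n. d (n + N)\<bar> * measure M (space M))"
    proof (rule sum_mono)
      fix e assume "e \<in> F"
      then have e: "e \<in> L2 M" "L2_norm M e = 1"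
        using F L2_orthonormal_norm by (auto simp: L2_orthonormal_def)
      have "L2_inner M (kernel_op M ?k e) e
          = L2_inner M (kernel_op M (\<lambda>t u. \<Sum>n<N. k n t u) e) e + L2_inner M (kernel_op M (?r N) e) e"
        using kernel_form_add[OF \<kappa> r[of N] e(1)] by simp
      then show "cmod (L2_inner M (kernel_op M ?k e) e)
          \<le> cmod (L2_inner M (kernel_op M (\<lambda>t u. \<Sum>n<N. k n t u) e) e)
            + \<bar>\<Sum>n. d (n + N)\<bar> * measure M (space M)"
        using kernel_form_bound[OF r[of N] e] by (auto intro!: norm_triangle_le)
    qed
    also have "\<dots> \<le> (\<Sum>n<N. C n) + card F * (\<bar>\<Sum>n. d (n + N)\<bar> * measure M (space M))"
      unfolding sum.distrib using nuclear_kernelD(2)[OF partial F] by simp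
    finally show ?thesis .
  qed
  have "(\<lambda>N. \<Sum>n. d (n + N)) \<longlonglongrightarrow> 0" by (rule suminf_exist_split2[OF d])
  then have "(\<lambda>N. (\<Sum>n<N. C n) + card F * (\<bar>\<Sum>n. d (n + N)\<bar> * measure M (space M)))
      \<longlonglongrightarrow> (\<Sum>n. C n) + card F * (\<bar>0\<bar> * measure M (space M))"
    by (intro tendsto_intros summable_LIMSEQ C)
  from LIMSEQ_le_const[OF this] bound
  show "(\<Sum>e\<in>F. cmod (L2_inner M (kernel_op M ?k e) e)) \<le> (\<Sum>n. C n)"
    by simp
qed

text \<open>Cauchy-Schwarz for finite sums followed by Bessel for each factor. This is the trace
  norm bound for the rank one operator built from \<open>f\<close> and \<open>g\<close>, uniform in
  \<open>F\<close>.\<close>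

lemma sum_inner_products_le:
  assumes F: "finite F" "L2_orthonormal M F" and "f \<in> L2 M" "g \<in> L2 M"
  shows "(\<Sum>e\<in>F. cmod (L2_inner M f e) * cmod (L2_inner M g e)) \<le> L2_norm M f * L2_norm M g"
proof -
  have "(\<Sum>e\<in>F. cmod (L2_inner M f e) * cmod (L2_inner M g e))
      = (\<Sum>e\<in>F. \<bar>cmod (L2_inner M f e)\<bar> * \<bar>cmod (L2_inner M g e)\<bar>)" by simp
  also have "\<dots> \<le> L2_set (\<lambda>e. cmod (L2_inner M f e)) F * L2_set (\<lambda>e. cmod (L2_inner M g e)) F"
    by (rule L2_set_mult_ineq)
  also have "\<dots> \<le> L2_norm M f * L2_norm M g"
    unfolding L2_set_def
    by (intro mult_mono real_le_lsqrt L2_bessel assms) (auto intro: sum_nonneg)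
  finally show ?thesis .
qed

text \<open>
  This is the product of two Hilbert--Schmidt operators: integrate the Cauchy--Schwarz and Bessel
  inequalities over the intermediate variable.
\<close>

lemma nuclear_kernel_factor:
  fixes N :: "'b measure" and A B :: "'b \<Rightarrow> 'a \<Rightarrow> real"
  assumes "finite_measure N"
    and A_meas: "(\<lambda>(y, t). A y t) \<in> borel_measurable (N \<Otimes>\<^sub>M M)"
    and B_meas: "(\<lambda>(y, t). B y t) \<in> borel_measurable (N \<Otimes>\<^sub>M M)"
    and A: "\<And>y t. y \<in> space N \<Longrightarrow> t \<in> space M \<Longrightarrow> \<bar>A y t\<bar> \<le> \<alpha>"
    and B: "\<And>y t. y \<in> space N \<Longrightarrow> t \<in> space M \<Longrightarrow> \<bar>B y t\<bar> \<le> \<beta>"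
    and c: "\<And>y. y \<in> space N \<Longrightarrow> L2_norm M (\<lambda>t. of_real (A y t)) * L2_norm M (\<lambda>t. of_real (B y t)) \<le> c"
  shows "nuclear_kernel M (c * measure N (space N)) (\<lambda>t u. LINT y|N. A y t * B y u)"
  unfolding nuclear_kernel_def
proof (intro conjI allI impI)
  interpret N: finite_measure N by fact
  interpret P: pair_sigma_finite N M ..
  note [measurable] = A_meas B_meas
  let ?k = "\<lambda>t u. LINT y|N. A y t * B y u"
  have [measurable]: "(\<lambda>t. A y t) \<in> borel_measurable M" "(\<lambda>t. B y t) \<in> borel_measurable M" if "y \<in> space N" for y
    using measurable_compose[OF measurable_Pair1'[OF that] A_meas] measurable_compose[OF measurable_Pair1'[OF that] B_meas]
    by simp_all
  have [measurable]: "(\<lambda>y. A y t) \<in> borel_measurable N" "(\<lambda>y. B y t) \<in> borel_measurable N" if "t \<in> space M" for t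
    using measurable_compose[OF measurable_Pair2'[OF that] A_meas] measurable_compose[OF measurable_Pair2'[OF that] B_meas]
    by simp_all
  have AB: "\<bar>A y t * B y u\<bar> \<le> \<bar>\<alpha>\<bar> * \<bar>\<beta>\<bar>" if "y \<in> space N" "t \<in> space M" "u \<in> space M" for y t u
    unfolding abs_mult using A[OF that(1,2)] B[OF that(1,3)] by (intro mult_mono) auto
  have AB_int: "integrable N (\<lambda>y. A y t * B y u)" if "t \<in> space M" "u \<in> space M" for t u
    by (rule N.integrable_const_bound[of _ "\<bar>\<alpha>\<bar> * \<bar>\<beta>\<bar>"]) (use that AB in auto)
  have "kernel_bound M (\<bar>\<alpha>\<bar> * \<bar>\<beta>\<bar> * measure N (space N)) ?k"
    unfolding kernel_bound_def
  proof (intro conjI ballI)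
    show "(\<lambda>(t, u). ?k t u) \<in> borel_measurable (M \<Otimes>\<^sub>M M)" by measurable
    fix t u assume tu: "t \<in> space M" "u \<in> space M"
    have "\<bar>?k t u\<bar> \<le> (LINT y|N. \<bar>A y t * B y u\<bar>)" by (rule integral_abs_bound)
    also have "\<dots> \<le> (LINT y|N. \<bar>\<alpha>\<bar> * \<bar>\<beta>\<bar>)"
      using AB_int[OF tu] AB[OF _ tu] by (intro integral_mono) auto
    finally show "\<bar>?k t u\<bar> \<le> \<bar>\<alpha>\<bar> * \<bar>\<beta>\<bar> * measure N (space N)" by (simp add: mult_ac)
  qed simp
  then show "\<exists>\<kappa>. kernel_bound M \<kappa> ?k" ..
  have AL: "(\<lambda>t. of_real (A y t)) \<in> L2 M" if "y \<in> space N" for y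
    by (rule L2_bounded[of _ \<alpha>]) (use A that in auto)
  have BL: "(\<lambda>t. of_real (B y t)) \<in> L2 M" if "y \<in> space N" for y
    by (rule L2_bounded[of _ \<beta>]) (use B that in auto)
  \<comment> \<open>Two applications of Fubini turn the form <k e, e> into the integral over y of
    \<open>p e y * cnj (q e y)\<close>. The suprema \<alpha> and \<beta> provide boundedness and
    integrability; the final constant sees only \<open>c\<close>, a bound on products of L^2 norms,
    and this difference makes the estimate for exponentials uniform.\<close>
  define p where "p e y = L2_inner M (\<lambda>t. of_real (A y t)) e" for e y
  define q where "q e y = L2_inner M (\<lambda>t. of_real (B y t)) e" for e y
  have pq: "integrable N (\<lambda>y. p e y * cnj (q e y))" "integrable N (\<lambda>y. cmod (p e y) * cmod (q e y))"
    "L2_inner M (kernel_op M ?k e) e = (LINT y|N. p e y * cnj (q e y))" if e: "e \<in> L2 M" for e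
  proof -
    have [measurable]: "e \<in> borel_measurable M" using e by (rule L2_measurable)
    have [measurable]: "p e \<in> borel_measurable N" "q e \<in> borel_measurable N"
      unfolding p_def[abs_def] q_def[abs_def] L2_inner_def by measurable
    have nA: "L2_norm M (\<lambda>t. of_real (A y t)) \<le> \<bar>\<alpha>\<bar> * sqrt (measure M (space M))" if "y \<in> space N" for y
      by (rule L2_norm_bounded) (use A[OF that] that in \<open>auto intro: order_trans[OF _ abs_ge_self]\<close>)
    have nB: "L2_norm M (\<lambda>t. of_real (B y t)) \<le> \<bar>\<beta>\<bar> * sqrt (measure M (space M))" if "y \<in> space N" for y
      by (rule L2_norm_bounded) (use B[OF that] that in \<open>auto intro: order_trans[OF _ abs_ge_self]\<close>)
    define P where "P = \<bar>\<alpha>\<bar> * sqrt (measure M (space M)) * L2_norm M e"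
    define Q where "Q = \<bar>\<beta>\<bar> * sqrt (measure M (space M)) * L2_norm M e"
    have p: "cmod (p e y) \<le> P" if "y \<in> space N" for y
      unfolding p_def P_def using L2_Cauchy_Schwarz[OF AL[OF that] e] nA[OF that]
      by (meson L2_norm_nonneg mult_right_mono order_trans)
    have q: "cmod (q e y) \<le> Q" if "y \<in> space N" for y
      unfolding q_def Q_def using L2_Cauchy_Schwarz[OF BL[OF that] e] nB[OF that]
      by (meson L2_norm_nonneg mult_right_mono order_trans)
    have PQ: "cmod (p e y) * cmod (q e y) \<le> P * Q" if "y \<in> space N" for y
      using p[OF that] q[OF that] by (intro mult_mono) (auto intro: order_trans[OF norm_ge_zero])
    show "integrable N (\<lambda>y. p e y * cnj (q e y))"
      by (rule N.integrable_const_bound[of _ "P * Q"]) (use PQ in \<open>auto simp: norm_mult\<close>)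
    show "integrable N (\<lambda>y. cmod (p e y) * cmod (q e y))"
      by (rule N.integrable_const_bound[of _ "P * Q"]) (use PQ in auto)
    have q_int: "integrable N (\<lambda>y. cnj (q e y))"
      by (rule N.integrable_const_bound[of _ Q]) (use q in auto)
    have q_eq: "cnj (q e y) = (LINT u|M. of_real (B y u) * e u)" for y
      unfolding q_def L2_inner_def Bochner_Integration.integral_cnj[symmetric] by simp
    have op: "kernel_op M ?k e t = (LINT y|N. of_real (A y t) * cnj (q e y))" if t: "t \<in> space M" for t
    proof -
      have int: "integrable (N \<Otimes>\<^sub>M M) (\<lambda>(y, u). of_real (A y t * B y u) * (1 * e u))"
      proof (rule P.integrable_bounded_kernel_mult)
        have [measurable]: "(\<lambda>y. A y t) \<in> borel_measurable N" using t by measurable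
        show "(\<lambda>(y, u). complex_of_real (A y t * B y u)) \<in> borel_measurable (N \<Otimes>\<^sub>M M)"
          by measurable
        show "cmod (complex_of_real (A y t * B y u)) \<le> \<bar>\<alpha>\<bar> * \<bar>\<beta>\<bar>" if "y \<in> space N" "u \<in> space M" for y u
          using AB[OF that(1) t that(2)] by (simp only: norm_of_real)
      qed (use L2_integrable[OF e] in auto)
      have "kernel_op M ?k e t = (LINT u|M. LINT y|N. of_real (A y t * B y u) * (1 * e u))"
        unfolding kernel_op_def integral_mult_left_zero integral_complex_of_real by simp
      also have "\<dots> = (LINT y|N. LINT u|M. of_real (A y t * B y u) * (1 * e u))"
        by (rule P.Fubini_integral[OF int])
      also have "\<dots> = (LINT y|N. of_real (A y t) * cnj (q e y))"
        unfolding q_eq by (simp add: mult.assoc)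
      finally show ?thesis .
    qed
    have int: "integrable (N \<Otimes>\<^sub>M M) (\<lambda>(y, t). of_real (A y t) * (cnj (q e y) * cnj (e t)))"
    proof (rule P.integrable_bounded_kernel_mult)
      show "(\<lambda>(y, u). complex_of_real (A y u)) \<in> borel_measurable (N \<Otimes>\<^sub>M M)" by measurable
      show "cmod (complex_of_real (A y u)) \<le> \<alpha>" if "y \<in> space N" "u \<in> space M" for y u
        using A[OF that] by simp
    qed (use q_int L2_integrable[OF L2_cnj[OF e]] in auto)
    have "L2_inner M (kernel_op M ?k e) e
        = (LINT t|M. LINT y|N. of_real (A y t) * (cnj (q e y) * cnj (e t)))"
      unfolding L2_inner_def
    proof (intro Bochner_Integration.integral_cong refl)
      fix t assume t: "t \<in> space M"
      have "kernel_op M ?k e t * cnj (e t) = (LINT y|N. of_real (A y t) * cnj (q e y) * cnj (e t))"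
        unfolding op[OF t] integral_mult_left_zero ..
      then show "kernel_op M ?k e t * cnj (e t) = (LINT y|N. of_real (A y t) * (cnj (q e y) * cnj (e t)))"
        by (simp only: mult.assoc)
    qed
    also have "\<dots> = (LINT y|N. LINT t|M. of_real (A y t) * (cnj (q e y) * cnj (e t)))"
      by (rule P.Fubini_integral[OF int])
    also have "\<dots> = (LINT y|N. p e y * cnj (q e y))"
    proof (intro Bochner_Integration.integral_cong refl)
      fix y
      have "p e y * cnj (q e y) = (LINT t|M. of_real (A y t) * cnj (e t) * cnj (q e y))"
        unfolding p_def L2_inner_def integral_mult_left_zero ..
      then show "(LINT t|M. of_real (A y t) * (cnj (q e y) * cnj (e t))) = p e y * cnj (q e y)"
        by (simp only: mult_ac)
    qed
    finally show "L2_inner M (kernel_op M ?k e) e = (LINT y|N. p e y * cnj (q e y))" .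
  qed
  fix F assume F: "finite F" "L2_orthonormal M F"
  then have F_L2: "e \<in> L2 M" if "e \<in> F" for e using that by (auto simp: L2_orthonormal_def)
  have "(\<Sum>e\<in>F. cmod (L2_inner M (kernel_op M ?k e) e))
      \<le> (\<Sum>e\<in>F. LINT y|N. cmod (p e y) * cmod (q e y))"
  proof (rule sum_mono)
    fix e assume "e \<in> F"
    then show "cmod (L2_inner M (kernel_op M ?k e) e) \<le> (LINT y|N. cmod (p e y) * cmod (q e y))"
      using integral_norm_bound[of N "\<lambda>y. p e y * cnj (q e y)"]
      by (simp add: pq(3)[OF F_L2] norm_mult)
  qed
  also have "\<dots> = (LINT y|N. (\<Sum>e\<in>F. cmod (p e y) * cmod (q e y)))"
    by (rule Bochner_Integration.integral_sum[symmetric]) (rule pq(2)[OF F_L2])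
  also have "\<dots> \<le> (LINT y|N. c)"
  proof (rule integral_mono)
    show "integrable N (\<lambda>y. (\<Sum>e\<in>F. cmod (p e y) * cmod (q e y)))"
      by (intro Bochner_Integration.integrable_sum pq(2) F_L2)
    show "(\<Sum>e\<in>F. cmod (p e y) * cmod (q e y)) \<le> c" if "y \<in> space N" for y
      unfolding p_def q_def
      by (rule order_trans[OF sum_inner_products_le[OF F AL[OF that] BL[OF that]] c[OF that]])
  qed simp
  finally show "(\<Sum>e\<in>F. cmod (L2_inner M (kernel_op M ?k e) e)) \<le> c * measure N (space N)"
    by (simp add: mult.commute)
qed

lemma nuclear_kernel_product:
  fixes f g :: "'a \<Rightarrow> real"
  assumes [measurable]: "f \<in> borel_measurable M" "g \<in> borel_measurable M"
    and f: "\<And>t. t \<in> space M \<Longrightarrow> \<bar>f t\<bar> \<le> \<alpha>" and g: "\<And>t. t \<in> space M \<Longrightarrow> \<bar>g t\<bar> \<le> \<beta>"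
    and "0 \<le> \<alpha>" "0 \<le> \<beta>"
  shows "nuclear_kernel M (\<alpha> * \<beta> * measure M (space M)) (\<lambda>t u. f t * g u)"
proof -
  \<comment> \<open>Over a one-point intermediate space the integral of f t * g u is f t * g u
    itself, so a rank one kernel is a special factorization.\<close>
  let ?N = "count_space (UNIV :: unit set)"
  let ?sqrt_mass = "sqrt (measure M (space M))"
  have "nuclear_kernel M ((\<alpha> * ?sqrt_mass) * (\<beta> * ?sqrt_mass) * measure ?N (space ?N)) (\<lambda>t u. LINT y|?N. f t * g u)"
  proof (rule nuclear_kernel_factor[where \<alpha> = \<alpha> and \<beta> = \<beta>])
    show "finite_measure ?N" by (intro finite_measure_count_space) simp
    show "L2_norm M (\<lambda>t. of_real (f t)) * L2_norm M (\<lambda>t. of_real (g t)) \<le> (\<alpha> * ?sqrt_mass) * (\<beta> * ?sqrt_mass)"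
      using assms by (intro mult_mono L2_norm_bounded) auto
  qed (use assms in auto)
  then show ?thesis
    by (simp add: measure_count_space mult_ac real_sqrt_mult_self lebesgue_integral_count_space_finite)
qed

end

section \<open>Kernels on an interval\<close>

abbreviation (input) leb_on :: "real set \<Rightarrow> real measure" where
  "leb_on S \<equiv> restrict_space lborel S"

lemma finite_measure_leb_on:
  assumes "S \<in> sets borel" "bounded S"
  shows "finite_measure (leb_on S)"
proof (rule finite_measureI)
  have "emeasure lborel S < \<infinity>" by (rule emeasure_bounded_finite[OF assms(2)])
  then show "emeasure (leb_on S) (space (leb_on S)) \<noteq> \<infinity>"
    using assms(1) by (simp add: emeasure_restrict_space space_restrict_space)
qed

lemma measure_leb_on:
  "0 \<le> a \<Longrightarrow> measure (leb_on {-a<..<a}) (space (leb_on {-a<..<a})) = 2 * a"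
  "0 \<le> a \<Longrightarrow> measure (leb_on {-a..a}) (space (leb_on {-a..a})) = 2 * a"
  by (simp_all add: measure_restrict_space space_restrict_space)

lemma borel_measurable_leb_on: "f \<in> borel_measurable borel \<Longrightarrow> f \<in> borel_measurable (leb_on S)"
  by (intro measurable_restrict_space1) simp

lemma borel_measurable_leb_on_pair:
  assumes "(\<lambda>(t, u). k t u) \<in> borel_measurable (borel \<Otimes>\<^sub>M borel)"
  shows "(\<lambda>(t, u). k t u) \<in> borel_measurable (leb_on S \<Otimes>\<^sub>M leb_on S')"
proof -
  have [measurable]: "(\<lambda>x. x) \<in> borel_measurable (leb_on S)" for S
    by (rule borel_measurable_leb_on) simp
  have "(\<lambda>z. (fst z, snd z)) \<in> leb_on S \<Otimes>\<^sub>M leb_on S' \<rightarrow>\<^sub>M borel \<Otimes>\<^sub>M borel"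
    by (intro measurable_Pair measurable_compose[OF measurable_fst] measurable_compose[OF measurable_snd]) auto
  from measurable_compose[OF this assms] show ?thesis by (simp add: split_beta)
qed

lemma integral_leb_on:
  fixes f :: "real \<Rightarrow> real"
  assumes "S \<in> sets borel"
  shows "(LINT y|leb_on S. f y) = (LINT y|lborel. f y * indicator S y)"
  using assms by (subst integral_restrict_space) (simp_all add: mult.commute)

text \<open>The integrand is supported on y \<le> min t u, where it is an exact derivative; t + u -
  2 min t u = |t - u| gives the upper endpoint, and the lower endpoint leaves the rank one term. Up
  to scaling this is the covariance of a stationary Ornstein-Uhlenbeck process, split into noise
  after -a and initial value. The factor 2c is shared evenly so that both factors have norm at most
  1.\<close>

lemma abs_exp_kernel_factor:
  fixes c a t u :: real
  assumes "0 < c" "t \<in> {-a<..<a}" "u \<in> {-a<..<a}"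
  shows "(LINT y|leb_on {-a..a}. (if y \<le> t then sqrt (2 * c) * exp (- c * (t - y)) else 0) *
            (if y \<le> u then sqrt (2 * c) * exp (- c * (u - y)) else 0))
       = exp (- c * \<bar>t - u\<bar>) - exp (- c * (t + a)) * exp (- c * (u + a))" (is "?lhs = _")
proof -
  let ?F = "\<lambda>y. exp (2 * c * y - c * t - c * u)"
  have "?lhs = (LINT y|lborel. (2 * c * ?F y) * indicator {-a..min t u} y)"
    unfolding integral_leb_on[OF atLeastAtMost_borel]
  proof (intro Bochner_Integration.integral_cong refl)
    fix y
    have "exp (- c * (t - y)) * exp (- c * (u - y)) = ?F y"
      by (simp add: exp_add[symmetric] algebra_simps)
    then have "(sqrt (2 * c) * exp (- c * (t - y))) * (sqrt (2 * c) * exp (- c * (u - y))) = 2 * c * ?F y"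
      using assms(1) by (simp add: real_sqrt_mult_self mult.assoc mult.left_commute[of "exp _"])
    then show "(if y \<le> t then sqrt (2 * c) * exp (- c * (t - y)) else 0) *
            (if y \<le> u then sqrt (2 * c) * exp (- c * (u - y)) else 0) * indicator {-a..a} y
          = (2 * c * ?F y) * indicator {-a..min t u} y"
      using assms by (auto simp: indicator_def)
  qed
  also have "\<dots> = ?F (min t u) - ?F (- a)"
  proof (rule integral_FTC_Icc_real)
    show "- a \<le> min t u" using assms by auto
    show "DERIV ?F x :> 2 * c * ?F x" for x
      by (auto intro!: derivative_eq_intros)
  qed (intro continuous_intros)
  also have "?F (min t u) = exp (- c * \<bar>t - u\<bar>)"
    by (simp add: min_def abs_if algebra_simps)
  also have "?F (- a) = exp (- c * (t + a)) * exp (- c * (u + a))"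
    by (simp add: exp_add[symmetric] algebra_simps)
  finally show ?thesis .
qed

text \<open>The integral of 2c exp(-2c(t - y)) over t from y to a is 1 - exp(-2c(a - y)). The
  supremum sqrt(2c) of the factor grows with c while its L^2 norm does not, which is the source of
  the uniformity in c.\<close>

lemma abs_exp_factor_norm:
  fixes c a y :: real
  assumes "0 < c" "y \<in> {-a..a}"
  shows "L2_norm (leb_on {-a<..<a}) (\<lambda>t. of_real (if y \<le> t then sqrt (2 * c) * exp (- c * (t - y)) else 0)) \<le> 1"
proof -
  let ?F = "\<lambda>t. - exp (- 2 * c * (t - y))"
  have hbi: "has_bochner_integral lborel (\<lambda>t. (2 * c * exp (- 2 * c * (t - y))) * indicator {y..a} t) (?F a - ?F y)"
  proof (rule has_bochner_integral_FTC_Icc_real)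
    show "y \<le> a" using assms by auto
    show "DERIV ?F x :> 2 * c * exp (- 2 * c * (x - y))" for x
      by (auto intro!: derivative_eq_intros)
  qed (intro continuous_intros)
  have sq: "(sqrt (2 * c) * exp (- c * (t - y)))\<^sup>2 = 2 * c * exp (- 2 * c * (t - y))" for t
    using assms(1) by (simp add: power_mult_distrib exp_double[symmetric] algebra_simps)
  have "(LINT t|leb_on {-a<..<a}. (cmod (of_real (if y \<le> t then sqrt (2 * c) * exp (- c * (t - y)) else 0)))\<^sup>2)
      = (LINT t|lborel. (2 * c * exp (- 2 * c * (t - y))) * indicator ({y..a} \<inter> {-a<..<a}) t)"
    unfolding integral_leb_on[OF greaterThanLessThan_borel]
  proof (intro Bochner_Integration.integral_cong refl)
    fix t
    show "(cmod (of_real (if y \<le> t then sqrt (2 * c) * exp (- c * (t - y)) else 0)))\<^sup>2 * indicator {-a<..<a} t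
      = (2 * c * exp (- 2 * c * (t - y))) * indicator ({y..a} \<inter> {-a<..<a}) t"
      unfolding norm_of_real power2_abs using sq[of t] by (auto simp: indicator_def)
  qed
  also have "\<dots> \<le> (LINT t|lborel. (2 * c * exp (- 2 * c * (t - y))) * indicator {y..a} t)"
  proof (rule integral_mono')
    show "integrable lborel (\<lambda>t. (2 * c * exp (- 2 * c * (t - y))) * indicator {y..a} t)"
      using hbi by (simp add: has_bochner_integral_iff)
  qed (use assms in \<open>auto simp: indicator_def\<close>)
  also have "\<dots> = ?F a - ?F y" using hbi by (simp add: has_bochner_integral_iff)
  also have "\<dots> \<le> 1" by simp
  finally show ?thesis unfolding L2_norm_def by simp
qed

text \<open>The constant is 2a from the integral over the intermediate variable plus 2a from the
  rank one term, whose factors are at most 1 because t + a and u + a are positive.\<close>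

lemma nuclear_kernel_abs_exp:
  fixes c a :: real
  assumes c: "0 < c" and a: "0 < a"
  shows "nuclear_kernel (leb_on {-a<..<a}) (4 * a) (\<lambda>t u. exp (- c * \<bar>t - u\<bar>))"
proof -
  let ?M = "leb_on {-a<..<a}" and ?N = "leb_on {-a..a}"
  interpret finite_measure ?M by (rule finite_measure_leb_on) auto
  let ?A = "\<lambda>y t. if y \<le> t then sqrt (2 * c) * exp (- c * (t - y)) else 0"
  have 1: "nuclear_kernel ?M (1 * measure ?N (space ?N)) (\<lambda>t u. LINT y|?N. ?A y t * ?A y u)"
  proof (rule nuclear_kernel_factor[where \<alpha> = "sqrt (2 * c)" and \<beta> = "sqrt (2 * c)"])
    show "finite_measure ?N" by (rule finite_measure_leb_on) auto
    show "(\<lambda>(y, t). ?A y t) \<in> borel_measurable (?N \<Otimes>\<^sub>M ?M)"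
      by (intro borel_measurable_leb_on_pair) measurable
    then show "(\<lambda>(y, t). ?A y t) \<in> borel_measurable (?N \<Otimes>\<^sub>M ?M)" .
    show "\<bar>?A y t\<bar> \<le> sqrt (2 * c)" "\<bar>?A y t\<bar> \<le> sqrt (2 * c)" for y t
      using c by (auto simp: abs_mult intro!: mult_left_le)
    show "L2_norm ?M (\<lambda>t. of_real (?A y t)) * L2_norm ?M (\<lambda>t. of_real (?A y t)) \<le> 1" if "y \<in> space ?N" for y
      using abs_exp_factor_norm[OF c, of y a] that
      by (intro mult_le_one) (auto simp: space_restrict_space)
  qed
  have 2: "nuclear_kernel ?M (1 * 1 * measure ?M (space ?M)) (\<lambda>t u. exp (- c * (t + a)) * exp (- c * (u + a)))"
    by (rule nuclear_kernel_product)
       (use c in \<open>auto intro!: borel_measurable_leb_on simp: space_restrict_space mult_nonneg_nonneg\<close>)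
  have "nuclear_kernel ?M (4 * a) (\<lambda>t u. (LINT y|?N. ?A y t * ?A y u) + exp (- c * (t + a)) * exp (- c * (u + a)))"
    using nuclear_kernel_add[OF 1 2]
    unfolding measure_leb_on(1)[OF less_imp_le[OF a]] measure_leb_on(2)[OF less_imp_le[OF a]] by simp
  then show ?thesis
  proof (rule nuclear_kernel_cong)
    fix t u assume "t \<in> space ?M" "u \<in> space ?M"
    then show "(LINT y|?N. ?A y t * ?A y u) + exp (- c * (t + a)) * exp (- c * (u + a)) = exp (- c * \<bar>t - u\<bar>)"
      using abs_exp_kernel_factor[OF c, of t a u] by (simp add: space_restrict_space)
  qed
qed

lemma nuclear_kernel_continuous_product:
  fixes f g :: "real \<Rightarrow> real"
  assumes "continuous_on UNIV f" "continuous_on UNIV g"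
  obtains C where "nuclear_kernel (leb_on {-a<..<a}) C (\<lambda>t u. f t * g u)"
proof -
  let ?M = "leb_on {-a<..<a}"
  interpret finite_measure ?M by (rule finite_measure_leb_on) auto
  have bound: "\<exists>B. 0 \<le> B \<and> (\<forall>x\<in>{-a<..<a}. \<bar>h x\<bar> \<le> B)" if "continuous_on UNIV h" for h :: "real \<Rightarrow> real"
  proof -
    have "compact (h ` {-a..a})"
      by (intro compact_continuous_image continuous_on_subset[OF that]) auto
    then have "bounded (h ` {-a..a})" by (rule compact_imp_bounded)
    then obtain B where "0 < B" "\<forall>x\<in>h ` {-a..a}. norm x \<le> B" by (auto simp: bounded_pos)
    then show ?thesis by (intro exI[of _ B]) auto
  qed
  obtain \<alpha> \<beta> where "0 \<le> \<alpha>" "\<forall>x\<in>{-a<..<a}. \<bar>f x\<bar> \<le> \<alpha>" "0 \<le> \<beta>" "\<forall>x\<in>{-a<..<a}. \<bar>g x\<bar> \<le> \<beta>"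
    using bound[OF assms(1)] bound[OF assms(2)] by auto
  then have "nuclear_kernel ?M (\<alpha> * \<beta> * measure ?M (space ?M)) (\<lambda>t u. f t * g u)"
    by (intro nuclear_kernel_product borel_measurable_leb_on borel_measurable_continuous_onI assms)
       (auto simp: space_restrict_space)
  then show thesis by (rule that)
qed

lemma nuclear_kernel_abs_shift:
  fixes a l :: real
  assumes a: "0 < a"
  obtains C where "nuclear_kernel (leb_on {-a<..<a}) C (\<lambda>t u. \<bar>t - u - l\<bar>)"
proof -
  let ?M = "leb_on {-a<..<a}"
  interpret finite_measure ?M by (rule finite_measure_leb_on) auto
  \<comment> \<open>Large enough that the interval from t to u + l lies within [-R, R] for all t, u
    in (-a, a), so cutting off the intermediate variable loses nothing.\<close>
  define R where "R = a + \<bar>l\<bar>"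
  let ?N = "leb_on {-R..R}"
  let ?A = "\<lambda>y t :: real. if t \<le> y then 1 else 0 :: real"
  let ?B = "\<lambda>y u :: real. if y \<le> u + l then 1 else 0 :: real"
  have 1: "nuclear_kernel ?M (2 * a * measure ?N (space ?N)) (\<lambda>t u. LINT y|?N. ?A y t * ?B y u)"
  proof (rule nuclear_kernel_factor[where \<alpha> = 1 and \<beta> = 1])
    show "finite_measure ?N" by (rule finite_measure_leb_on) auto
    show "(\<lambda>(y, t). ?A y t) \<in> borel_measurable (?N \<Otimes>\<^sub>M ?M)"
      by (intro borel_measurable_leb_on_pair) measurable
    show "(\<lambda>(y, t). ?B y t) \<in> borel_measurable (?N \<Otimes>\<^sub>M ?M)"
      by (intro borel_measurable_leb_on_pair) measurable
    show "L2_norm ?M (\<lambda>t. of_real (?A y t)) * L2_norm ?M (\<lambda>t. of_real (?B y t)) \<le> 2 * a" for y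
    proof -
      have "L2_norm ?M (\<lambda>t. of_real (?A y t)) \<le> 1 * sqrt (2 * a)"
        unfolding measure_leb_on(1)[OF less_imp_le[OF a], symmetric]
        by (rule L2_norm_bounded) (auto intro!: borel_measurable_leb_on)
      moreover have "L2_norm ?M (\<lambda>t. of_real (?B y t)) \<le> 1 * sqrt (2 * a)"
        unfolding measure_leb_on(1)[OF less_imp_le[OF a], symmetric]
        by (rule L2_norm_bounded) (auto intro!: borel_measurable_leb_on)
      ultimately have "L2_norm ?M (\<lambda>t. of_real (?A y t)) * L2_norm ?M (\<lambda>t. of_real (?B y t))
          \<le> (1 * sqrt (2 * a)) * (1 * sqrt (2 * a))"
        using a by (intro mult_mono) auto
      then show ?thesis using a by simp
    qed
  qed auto
  have max_eq: "(LINT y|?N. ?A y t * ?B y u) = max 0 (u + l - t)" if "t \<in> {-a<..<a}" "u \<in> {-a<..<a}" for t u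
  proof -
    have "(LINT y|?N. ?A y t * ?B y u) = (LINT y|lborel. indicator {t..u+l} y)"
      unfolding integral_leb_on[OF atLeastAtMost_borel]
      by (intro Bochner_Integration.integral_cong refl) (use that in \<open>auto simp: indicator_def R_def\<close>)
    then show ?thesis by (simp add: max_def)
  qed
  obtain C2 where 2: "nuclear_kernel ?M C2 (\<lambda>t u. (t - l) * 1)"
    by (rule nuclear_kernel_continuous_product[of "\<lambda>t. t - l" "\<lambda>_. 1"]) (auto intro!: continuous_intros)
  obtain C3 where 3: "nuclear_kernel ?M C3 (\<lambda>t u. 1 * (- u))"
    by (rule nuclear_kernel_continuous_product[of "\<lambda>_. 1" "\<lambda>u. - u"]) (auto intro!: continuous_intros)
  \<comment> \<open>The identity |x| = 2 max(0, -x) + x with x = t - u - l; the linear part splits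
    into the two rank one kernels (t - l) * 1 and 1 * (-u).\<close>
  note nuclear_kernel_add[OF nuclear_kernel_scale[OF 1, of 2] nuclear_kernel_add[OF 2 3]]
  then show thesis
    by (intro that) (erule nuclear_kernel_cong, auto simp: space_restrict_space max_eq max_def)
qed

section \<open>The screw kernel\<close>

text \<open>Uniform continuity of \<open>k\<close> on the closed square makes the images of unit
  vectors equicontinuous as well as uniformly bounded. Arzela-Ascoli extracts a uniformly convergent
  subsequence, and uniform convergence implies L^2 convergence on a bounded interval.\<close>

lemma compact_hermitian_kernel_leb_on:
  fixes k :: "real \<Rightarrow> real \<Rightarrow> real"
  assumes k: "continuous_on UNIV (\<lambda>(t, u). k t u)" and sym: "\<And>t u. k u t = k t u"
    and T: "\<And>f t. f \<in> L2 (leb_on {-a<..<a}) \<Longrightarrow> t \<in> {-a<..<a} \<Longrightarrow> T f t = kernel_op (leb_on {-a<..<a}) k f t"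
  obtains \<kappa> where "compact_hermitian_kernel (leb_on {-a<..<a}) (\<lambda>t u. of_real (k t u)) \<kappa> T"
proof -
  let ?M = "leb_on {-a<..<a}" and ?S = "{-a..a}"
  interpret finite_measure ?M by (rule finite_measure_leb_on) auto
  have [measurable]: "(\<lambda>(t, u). k t u) \<in> borel_measurable (borel \<Otimes>\<^sub>M borel)"
    using borel_measurable_continuous_onI[OF k] by (simp add: borel_prod)
  have comp: "compact (?S \<times> ?S)" by (intro compact_Times compact_Icc)
  have k_S: "continuous_on (?S \<times> ?S) (\<lambda>(t, u). k t u)"
    by (rule continuous_on_subset[OF k]) auto
  obtain \<kappa> where \<kappa>: "0 < \<kappa>" "\<And>t u. t \<in> ?S \<Longrightarrow> u \<in> ?S \<Longrightarrow> \<bar>k t u\<bar> \<le> \<kappa>"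
    using compact_imp_bounded[OF compact_continuous_image[OF k_S comp]]
    unfolding bounded_pos by (auto simp: image_iff)
  have "compact_hermitian_kernel ?M (\<lambda>t u. of_real (k t u)) \<kappa> T"
  proof (unfold_locales)
    show "(\<lambda>(t, u). complex_of_real (k t u)) \<in> borel_measurable (?M \<Otimes>\<^sub>M ?M)"
      by (intro borel_measurable_leb_on_pair) measurable
    show "cmod (of_real (k t u)) \<le> \<kappa>" if "t \<in> space ?M" "u \<in> space ?M" for t u
      using that \<kappa>(2)[of t u] by (simp add: space_restrict_space)
    show "complex_of_real (k u t) = cnj (of_real (k t u))" for t u
      by (simp add: sym[of u t])
    show "T f t = (LINT u|?M. of_real (k t u) * f u)" if "f \<in> L2 ?M" "t \<in> space ?M" for f t
      using T[OF that(1)] that(2) by (simp add: space_restrict_space kernel_op_def)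
  next
    fix f :: "nat \<Rightarrow> real \<Rightarrow> complex"
    assume f: "\<And>n. f n \<in> L2 ?M" "\<And>n. L2_norm ?M (f n) = 1"
    \<comment> \<open>\<open>T\<close> is tied to the kernel only on the open interval.
      \<open>F\<close> extends the images to the closed one, where Arzela-Ascoli applies.\<close>
    define F where "F n t = kernel_op ?M k (f n) t" for n t
    let ?m = "sqrt (measure ?M (space ?M))"
    have row_meas: "(\<lambda>u. complex_of_real (k t u)) \<in> borel_measurable ?M" for t
      by (intro borel_measurable_leb_on) measurable
    have row: "(\<lambda>u. complex_of_real (k t u)) \<in> L2 ?M" if "t \<in> ?S" for t
      by (rule L2_bounded[OF row_meas, of _ \<kappa>]) (use that \<kappa>(2)[of t] in \<open>auto simp: space_restrict_space\<close>)
    have F_inner: "F n t = L2_inner ?M (f n) (\<lambda>u. of_real (k t u))" for n t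
      by (simp add: F_def kernel_op_def L2_inner_def mult.commute)
    have F_bound: "norm (F n t) \<le> \<kappa> * ?m" if "t \<in> ?S" for n t
    proof -
      have "norm (F n t) \<le> L2_norm ?M (\<lambda>u. complex_of_real (k t u))"
        using L2_Cauchy_Schwarz[OF f(1) row[OF that]] unfolding F_inner by (simp add: f(2))
      also have "\<dots> \<le> \<kappa> * ?m"
        by (rule L2_norm_bounded[OF row_meas]) (use that \<kappa>(1) \<kappa>(2)[of t] in \<open>auto simp: space_restrict_space\<close>)
      finally show ?thesis .
    qed
    have equi: "\<exists>d>0. \<forall>n y. y \<in> ?S \<and> norm (x - y) < d \<longrightarrow> norm (F n x - F n y) < e"
      if x: "x \<in> ?S" and e: "0 < e" for x e
    proof -
      \<comment> \<open>Adding 1 keeps the denominator positive and makes \<open>e' * ?m < e\<close>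
        strict.\<close>
      define e' where "e' = e / (?m + 1)"
      have e': "0 < e'" "e' * ?m < e"
        using e by (auto simp: e'_def field_simps add_pos_nonneg intro!: divide_pos_pos)
      obtain d where d: "0 < d" "\<And>z z'. z \<in> ?S \<times> ?S \<Longrightarrow> z' \<in> ?S \<times> ?S \<Longrightarrow> dist z' z < d \<Longrightarrow>
          dist (case z' of (t, u) \<Rightarrow> k t u) (case z of (t, u) \<Rightarrow> k t u) < e'"
        using compact_uniformly_continuous[OF k_S comp] e'(1) unfolding uniformly_continuous_on_def by metis
      have "norm (F n x - F n y) < e" if y: "y \<in> ?S" "norm (x - y) < d" for n y
      proof -
        have diff: "cmod (of_real (k x u) - of_real (k y u)) \<le> e'" if "u \<in> ?S" for u
          using d(2)[of "(y, u)" "(x, u)"] that x y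
          by (simp add: dist_prod_def dist_real_def of_real_diff[symmetric] del: of_real_diff)
        have "norm (F n x - F n y) = cmod (L2_inner ?M (f n) (\<lambda>u. of_real (k x u) - of_real (k y u)))"
          unfolding F_inner by (simp add: L2_inner_diff_right[OF row[OF x] row[OF y(1)] f(1)])
        also have "\<dots> \<le> L2_norm ?M (\<lambda>u. complex_of_real (k x u) - of_real (k y u))"
          using L2_Cauchy_Schwarz[OF f(1) L2_diff[OF row[OF x] row[OF y(1)]]] by (simp add: f(2))
        also have "\<dots> \<le> e' * ?m"
          by (rule L2_norm_bounded) (use row_meas e'(1) diff in \<open>auto simp: space_restrict_space\<close>)
        finally show ?thesis using e'(2) by simp
      qed
      then show ?thesis using d(1) by blast
    qed
    obtain g r where g: "continuous_on ?S g" and r: "strict_mono (r :: nat \<Rightarrow> nat)"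
      and lim: "\<And>e. 0 < e \<Longrightarrow> \<exists>N. \<forall>n x. n \<ge> N \<and> x \<in> ?S \<longrightarrow> norm (F (r n) x - g x) < e"
      using Arzela_Ascoli[OF compact_Icc F_bound equi] by metis
    have g_meas: "g \<in> borel_measurable ?M"
    proof -
      have "g \<in> borel_measurable (restrict_space borel {-a<..<a})"
        by (rule borel_measurable_continuous_on_restrict) (rule continuous_on_subset[OF g], auto)
      then show ?thesis
        by (simp cong: measurable_cong_sets add: sets_restrict_space_cong[OF sets_lborel])
    qed
    obtain B where "\<forall>x\<in>?S. cmod (g x) \<le> B"
      using compact_imp_bounded[OF compact_continuous_image[OF g compact_Icc]] by (auto simp: bounded_iff)
    then have gL2: "g \<in> L2 ?M"
      by (intro L2_bounded[OF g_meas, of B]) (auto simp: space_restrict_space)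
    have T_meas: "(\<lambda>x. T (f n) x - g x) \<in> borel_measurable ?M" for n
    proof -
      have "kernel_bound ?M \<kappa> k"
        unfolding kernel_bound_def using \<kappa> by (auto simp: space_restrict_space intro!: borel_measurable_leb_on_pair)
      from bounded_kernel.T_measurable[OF kernel_bound_bounded_kernel[OF this] f(1)[of n]]
      have [measurable]: "kernel_op ?M k (f n) \<in> borel_measurable ?M" .
      have [measurable]: "g \<in> borel_measurable ?M" by (rule g_meas)
      have "(\<lambda>x. kernel_op ?M k (f n) x - g x) \<in> borel_measurable ?M" by measurable
      then show ?thesis
        by (subst measurable_cong[where g = "\<lambda>x. kernel_op ?M k (f n) x - g x"])
           (auto simp: space_restrict_space T f(1))
    qed
    have "(\<lambda>n. L2_norm ?M (\<lambda>x. T (f (r n)) x - g x)) \<longlonglongrightarrow> 0"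
    proof (rule LIMSEQ_I)
      fix e :: real assume e: "0 < e"
      define e' where "e' = e / (?m + 1)"
      have e': "0 < e'" "e' * ?m < e"
        using e by (auto simp: e'_def field_simps add_pos_nonneg intro!: divide_pos_pos)
      obtain N where N: "\<And>n x. n \<ge> N \<Longrightarrow> x \<in> ?S \<Longrightarrow> norm (F (r n) x - g x) < e'"
        using lim[OF e'(1)] by blast
      have "L2_norm ?M (\<lambda>x. T (f (r n)) x - g x) \<le> e' * ?m" if "n \<ge> N" for n
        by (rule L2_norm_bounded[OF T_meas])
           (use e'(1) N[OF that] in \<open>auto simp: space_restrict_space T f(1) F_def intro: less_imp_le\<close>)
      then show "\<exists>N. \<forall>n\<ge>N. norm (L2_norm ?M (\<lambda>x. T (f (r n)) x - g x) - 0) < e"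
        using e'(2) by (intro exI[of _ N]) fastforce
    qed
    then show "\<exists>h\<in>L2 ?M. \<exists>r. strict_mono (r :: nat \<Rightarrow> nat) \<and> (\<lambda>n. L2_norm ?M (\<lambda>x. T (f (r n)) x - h x)) \<longlonglongrightarrow> 0"
      using gL2 r by blast
  qed (use \<kappa>(1) in simp)
  then show thesis by (rule that)
qed

text \<open>The operator integrates over the closed interval, whereas \<open>f\<close> is measurable
  on the open one and arbitrary at the endpoints. The endpoints are a null set, but measurability of
  the closed integrand has to be restored before almost everywhere equality can be used.\<close>

lemma screw_operator_eq_kernel_op:
  assumes f: "f \<in> borel_measurable (leb_on {-a<..<a})" and t: "t \<in> {-a<..<a}"
    and k [measurable]: "(\<lambda>u. screw_kernel g t u) \<in> borel_measurable borel"
  shows "screw_operator g a f t = kernel_op (leb_on {-a<..<a}) (screw_kernel g) f t"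
proof -
  define h where "h u = complex_of_real (screw_kernel g t u) * f u" for u
  have "(\<lambda>u. complex_of_real (screw_kernel g t u)) \<in> borel_measurable (leb_on {-a<..<a})"
    by (intro borel_measurable_leb_on) measurable
  with f have "h \<in> borel_measurable (leb_on {-a<..<a})"
    unfolding h_def[abs_def] by (rule borel_measurable_times[rotated])
  then have [measurable]: "(\<lambda>u. indicator {-a<..<a} u *\<^sub>R h u) \<in> borel_measurable lborel"
    by (subst (asm) borel_measurable_restrict_space_iff) simp_all
  \<comment> \<open>The closed integrand is the measurable open one plus two multiples of indicators
    of points. The point \<open>t\<close> guarantees -a < a, so the endpoints are distinct and none
    is counted twice.\<close>
  have eq: "indicator {-a..a} u *\<^sub>R h u = indicator {-a<..<a} u *\<^sub>R h u
      + (indicator {-a} u *\<^sub>R h (-a) + indicator {a} u *\<^sub>R h a)" for u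
    using t by (auto simp: indicator_def)
  have "screw_operator g a f t = (LINT u|lborel. indicator {-a..a} u *\<^sub>R h u)"
    using t by (simp add: screw_operator_def set_lebesgue_integral_def h_def)
  also have "\<dots> = (LINT u|lborel. indicator {-a<..<a} u *\<^sub>R h u)"
  proof (rule integral_cong_AE)
    show "(\<lambda>u. indicator {-a..a} u *\<^sub>R h u) \<in> borel_measurable lborel"
      unfolding eq by measurable
    show "AE u in lborel. indicator {-a..a} u *\<^sub>R h u = indicator {-a<..<a} u *\<^sub>R h u"
      using AE_lborel_singleton[of a] AE_lborel_singleton[of "-a"]
      by eventually_elim (auto simp: indicator_def)
  qed measurable
  also have "\<dots> = kernel_op (leb_on {-a<..<a}) (screw_kernel g) f t"
    unfolding kernel_op_def by (subst integral_restrict_space) (simp_all add: h_def)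
  finally show ?thesis .
qed

section \<open>Series expansion and continuity of \<open>Psi\<close>\<close>

lemma summable_lerch: "summable (\<lambda>n. (real n + 1/4) powr (- 2))"
proof (rule summable_comparison_test')
  show "summable (\<lambda>n. real n powr (- 2))" by (simp add: summable_real_powr_iff)
  \<comment> \<open>The comparison starts at 1, since \<open>0 powr (- 2)\<close> is 0 and does not
    dominate the first term.\<close>
  show "norm ((real n + 1/4) powr (- 2)) \<le> real n powr (- 2)" if "1 \<le> n" for n
    using that by (simp add: powr_mono2')
qed

lemma lerch_term_le:
  "\<bar>(real n + 1/4) powr (- 2) * exp (- (2 * real n + 1/2) * \<bar>x\<bar>)\<bar> \<le> (real n + 1/4) powr (- 2)"
  by (simp add: abs_mult mult_left_le mult_nonpos_nonneg)

text \<open>The Lerch term of \<open>Psi\<close> with its prefactor exp(-|x|/2) moved inside the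
  sum, so that each summand is a multiple of exp(-c |x|) with c = 2n + 1/2.\<close>

definition lerch_series :: "real \<Rightarrow> real" where
  "lerch_series x = (\<Sum>n. (real n + 1/4) powr (- 2) * exp (- (2 * real n + 1/2) * \<bar>x\<bar>))"

lemma lerch_Phi_exp:
  assumes "0 \<le> t"
  shows "exp (- t / 2) * lerch_Phi (exp (- 2 * t)) 2 (1 / 4) = lerch_series t"
proof -
  have eq: "(real n + 1/4) powr (- 2) * exp (- (2 * real n + 1/2) * \<bar>t\<bar>)
      = exp (- t / 2) * ((real n + 1/4) powr (- 2) * exp (- 2 * t) ^ n)" for n
    using assms by (simp add: exp_of_nat_mult[symmetric] exp_add[symmetric] algebra_simps)
  have "summable (\<lambda>n. (real n + 1/4) powr (- 2) * exp (- 2 * t) ^ n)"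
  proof (rule summable_comparison_test'[OF summable_lerch, of 0])
    show "norm ((real n + 1/4) powr (- 2) * exp (- 2 * t) ^ n) \<le> (real n + 1/4) powr (- 2)" for n
      using assms by (auto simp: abs_mult intro!: mult_left_le power_le_one)
  qed
  then show ?thesis
    unfolding lerch_series_def lerch_Phi_def eq by (rule suminf_mult[symmetric])
qed

lemma continuous_on_lerch_series: "continuous_on UNIV lerch_series"
proof (rule uniform_limit_theorem)
  show "uniform_limit UNIV (\<lambda>N x. \<Sum>n<N. (real n + 1/4) powr (- 2) * exp (- (2 * real n + 1/2) * \<bar>x\<bar>))
      lerch_series sequentially"
    unfolding lerch_series_def
    by (rule Weierstrass_m_test[OF _ summable_lerch]) (use lerch_term_le in simp)
qed (auto intro!: always_eventually continuous_intros)

definition mangoldt_range :: "real \<Rightarrow> nat set" where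
  "mangoldt_range R = {n. 1 \<le> n \<and> real n \<le> exp R}"

lemma finite_mangoldt_range: "finite (mangoldt_range R)"
proof (rule finite_subset)
  show "mangoldt_range R \<subseteq> {..nat \<lfloor>exp R\<rfloor>}"
    by (auto simp: mangoldt_range_def le_nat_floor)
qed simp

text \<open>
  On a bounded interval the sum over \<open>n \<le> e\<^sup>t\<close> has a fixed range once \<open>t - log n\<close> is replaced by
  its positive part, and the positive part is a combination of \<open>\<bar>x - log n\<bar>\<close>, \<open>\<bar>x + log n\<bar>\<close>, and a
  constant.
\<close>

lemma Psi_expansion:
  assumes "\<bar>x\<bar> \<le> R"
  shows "Psi x = 4 * exp (x / 2) + 4 * exp (- x / 2)
    + (\<Sum>n\<in>mangoldt_range R. (- mangoldt n / (2 * sqrt n)) * (\<bar>x - ln n\<bar> + \<bar>x - (- ln n)\<bar>))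
    + (Digamma (1 / 4) - ln pi) / 2 * \<bar>x - 0\<bar>
    + ((\<Sum>n\<in>mangoldt_range R. mangoldt n / sqrt n * ln n) + 1 / 4 * (pi\<^sup>2 + 8 * catalan) - 8)
    + (- 1 / 4) * lerch_series x"
proof -
  have "(\<Sum>n | 1 \<le> n \<and> real n \<le> exp \<bar>x\<bar>. mangoldt n / sqrt (real n) * (\<bar>x\<bar> - ln (real n)))
      = (\<Sum>n\<in>mangoldt_range R. mangoldt n / sqrt (real n) * ((\<bar>x - ln n\<bar> + \<bar>x - (- ln n)\<bar>) / 2 - ln n))"
  \<comment> \<open>For l = ln n \<ge> 0 the mean of |x - l| and |x + l| is max |x| l. The new
    summand is therefore the positive part of |x| - l, which vanishes on all indices added to the
    range.\<close>
  proof (rule sum.mono_neutral_cong_left)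
    show "{n. 1 \<le> n \<and> real n \<le> exp \<bar>x\<bar>} \<subseteq> mangoldt_range R"
    proof -
      have "exp \<bar>x\<bar> \<le> exp R" using assms by simp
      then show ?thesis by (auto simp: mangoldt_range_def intro: order_trans simp del: exp_le_cancel_iff)
    qed
    show "\<forall>n\<in>mangoldt_range R - {n. 1 \<le> n \<and> real n \<le> exp \<bar>x\<bar>}.
        mangoldt n / sqrt (real n) * ((\<bar>x - ln n\<bar> + \<bar>x - (- ln n)\<bar>) / 2 - ln n) = 0"
    proof
      fix n assume "n \<in> mangoldt_range R - {n. 1 \<le> n \<and> real n \<le> exp \<bar>x\<bar>}"
      then have "1 \<le> n" "exp \<bar>x\<bar> < real n" by (auto simp: mangoldt_range_def)
      then have "\<bar>x\<bar> < ln (real n)" by (subst exp_less_cancel_iff[symmetric]) simp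
      then have "(\<bar>x - ln n\<bar> + \<bar>x - (- ln n)\<bar>) / 2 - ln n = 0" by (simp add: abs_if split: if_splits)
      then show "mangoldt n / sqrt (real n) * ((\<bar>x - ln n\<bar> + \<bar>x - (- ln n)\<bar>) / 2 - ln n) = 0" by simp
    qed
    show "mangoldt n / sqrt (real n) * (\<bar>x\<bar> - ln (real n))
        = mangoldt n / sqrt (real n) * ((\<bar>x - ln n\<bar> + \<bar>x - (- ln n)\<bar>) / 2 - ln n)"
      if "n \<in> {n. 1 \<le> n \<and> real n \<le> exp \<bar>x\<bar>}" for n
    proof -
      have "ln (real n) \<le> \<bar>x\<bar>" "0 \<le> ln (real n)"
        using that by (auto simp: ln_ge_zero intro: ln_le_cancel_iff[THEN iffD2, of _ "exp \<bar>x\<bar>", simplified])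
      then have "\<bar>x\<bar> - ln (real n) = (\<bar>x - ln n\<bar> + \<bar>x - (- ln n)\<bar>) / 2 - ln n"
        by (simp add: abs_if split: if_splits)
      then show ?thesis by simp
    qed
  qed (rule finite_mangoldt_range)
  also have "\<dots> = - (\<Sum>n\<in>mangoldt_range R. (- mangoldt n / (2 * sqrt n)) * (\<bar>x - ln n\<bar> + \<bar>x - (- ln n)\<bar>))
      - (\<Sum>n\<in>mangoldt_range R. mangoldt n / sqrt n * ln n)"
    by (simp add: sum_negf[symmetric] sum_subtractf[symmetric] diff_divide_distrib algebra_simps add_divide_distrib)
  finally have sum_eq: "(\<Sum>n | 1 \<le> n \<and> real n \<le> exp \<bar>x\<bar>. mangoldt n / sqrt (real n) * (\<bar>x\<bar> - ln (real n))) = \<dots>" .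
  have "exp (\<bar>x\<bar> / 2) + exp (- \<bar>x\<bar> / 2) = exp (x / 2) + exp (- x / 2)"
    by (simp add: abs_if)
  moreover have "lerch_series \<bar>x\<bar> = lerch_series x"
    by (simp add: lerch_series_def)
  ultimately show ?thesis
    unfolding Psi_def Psi_nonneg_def sum_eq lerch_Phi_exp[OF abs_ge_zero]
    by (simp add: field_simps)
qed

text \<open>In the definition the range of summation jumps with the argument. Near \<open>x\<close>
  the expansion with R = |x| + 1 has a fixed finite range and continuous terms.\<close>

lemma continuous_on_Psi: "continuous_on UNIV Psi"
proof (rule continuous_at_imp_continuous_on, rule ballI)
  fix x :: real
  define R where "R = \<bar>x\<bar> + 1"
  have "continuous_on {-R<..<R} Psi"
    by (subst continuous_on_cong[OF refl Psi_expansion[of _ R]])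
       (auto intro!: continuous_intros continuous_on_subset[OF continuous_on_lerch_series]
         simp: mangoldt_range_def)
  then show "isCont Psi x"
    by (rule continuous_on_interior) (auto simp: R_def)
qed

text \<open>Differences of points in (-a, a) satisfy |t - u| \<le> 2a, so one finite range of n
  serves all of them. The exponentials of (t - u) / 2 factor into rank one kernels, and the Lerch
  terms have the constants 4a (n + 1/4)^(-2), which are summable.\<close>

lemma nuclear_kernel_Psi:
  assumes a: "0 < a"
  obtains C where "nuclear_kernel (leb_on {-a<..<a}) C (\<lambda>t u. Psi (t - u))"
proof -
  let ?M = "leb_on {-a<..<a}" and ?R = "mangoldt_range (2 * a)"
  interpret finite_measure ?M by (rule finite_measure_leb_on) auto
  let ?q = "\<lambda>n. (real n + 1/4) powr (- 2)"
  obtain C1 where 1: "nuclear_kernel ?M C1 (\<lambda>t u. 4 * exp (t / 2) * exp (- u / 2))"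
    by (rule nuclear_kernel_continuous_product[of "\<lambda>t. 4 * exp (t / 2)" "\<lambda>u. exp (- u / 2)"])
       (auto intro!: continuous_intros)
  obtain C2 where 2: "nuclear_kernel ?M C2 (\<lambda>t u. 4 * exp (- t / 2) * exp (u / 2))"
    by (rule nuclear_kernel_continuous_product[of "\<lambda>t. 4 * exp (- t / 2)" "\<lambda>u. exp (u / 2)"])
       (auto intro!: continuous_intros)
  have "\<exists>C. nuclear_kernel ?M C (\<lambda>t u. \<bar>t - u - l\<bar>)" for l
    by (rule nuclear_kernel_abs_shift[OF a]) blast
  \<comment> \<open>One constant is chosen for each shift, so that the constants can be summed over
    the shifts ln n and -ln n.\<close>
  then obtain A where A: "\<And>l. nuclear_kernel ?M (A l) (\<lambda>t u. \<bar>t - u - l\<bar>)" by metis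
  have 3: "nuclear_kernel ?M (\<Sum>n\<in>?R. \<bar>- mangoldt n / (2 * sqrt n)\<bar> * (A (ln n) + A (- ln n)))
      (\<lambda>t u. \<Sum>n\<in>?R. (- mangoldt n / (2 * sqrt n)) * (\<bar>t - u - ln n\<bar> + \<bar>t - u - (- ln n)\<bar>))"
    by (intro nuclear_kernel_sum nuclear_kernel_scale nuclear_kernel_add A)
  note 4 = nuclear_kernel_scale[OF A[of 0], of "(Digamma (1 / 4) - ln pi) / 2"]
  let ?E = "(\<Sum>n\<in>?R. mangoldt n / sqrt n * ln n) + 1 / 4 * (pi\<^sup>2 + 8 * catalan) - 8"
  obtain C5 where 5: "nuclear_kernel ?M C5 (\<lambda>t u. ?E * 1)"
    by (rule nuclear_kernel_continuous_product[of "\<lambda>t. ?E" "\<lambda>u. 1"])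
       (auto intro!: continuous_intros)
  have "nuclear_kernel ?M (\<Sum>n. ?q n * (4 * a)) (\<lambda>t u. \<Sum>n. ?q n * exp (- (2 * real n + 1/2) * \<bar>t - u\<bar>))"
  proof (rule nuclear_kernel_series[OF _ _ lerch_term_le summable_lerch])
    show "nuclear_kernel ?M (?q n * (4 * a)) (\<lambda>t u. ?q n * exp (- (2 * real n + 1/2) * \<bar>t - u\<bar>))" for n
      using nuclear_kernel_scale[OF nuclear_kernel_abs_exp[of "2 * real n + 1/2", OF _ a], of "?q n"] by simp
    show "summable (\<lambda>n. ?q n * (4 * a))" by (intro summable_mult2 summable_lerch)
  qed
  then have 6: "nuclear_kernel ?M (\<bar>- 1 / 4\<bar> * (\<Sum>n. ?q n * (4 * a))) (\<lambda>t u. (- 1 / 4) * lerch_series (t - u))"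
    unfolding lerch_series_def by (rule nuclear_kernel_scale)
  note nuclear_kernel_cong[OF nuclear_kernel_add[OF nuclear_kernel_add[OF nuclear_kernel_add[OF
        nuclear_kernel_add[OF nuclear_kernel_add[OF 1 2] 3] 4] 5] 6], of "\<lambda>t u. Psi (t - u)"]
  then show thesis
  proof (rule that)
    fix t u assume "t \<in> space ?M" "u \<in> space ?M"
    then have "\<bar>t - u\<bar> \<le> 2 * a" by (auto simp: space_restrict_space)
    have "exp ((t - u) / 2) = exp (t / 2) * exp (- u / 2)" "exp (- (t - u) / 2) = exp (- t / 2) * exp (u / 2)"
      by (simp_all add: exp_add[symmetric] diff_divide_distrib)
    note Psi_expansion[OF \<open>\<bar>t - u\<bar> \<le> 2 * a\<close>, unfolded this]
    then show "4 * exp (t / 2) * exp (- u / 2) + 4 * exp (- t / 2) * exp (u / 2)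
      + (\<Sum>n\<in>?R. - mangoldt n / (2 * sqrt n) * (\<bar>t - u - ln n\<bar> + \<bar>t - u - - ln n\<bar>))
      + (Digamma (1 / 4) - ln pi) / 2 * \<bar>t - u - 0\<bar> + ?E * 1 + - 1 / 4 * lerch_series (t - u) = Psi (t - u)"
      by (simp add: mult.assoc)
  qed
qed

theorem theorem1p5:
  fixes a :: real
  assumes "0 < a"
  shows "L2_trace_class (restrict_space lborel {-a<..<a}) (screw_operator (\<lambda>t. - Psi t) a)"
proof -
  let ?M = "leb_on {-a<..<a}" and ?k = "screw_kernel (\<lambda>t. - Psi t)" and ?T = "screw_operator (\<lambda>t. - Psi t) a"
  interpret finite_measure ?M by (rule finite_measure_leb_on) auto
  \<comment> \<open>The terms of the screw kernel in a single variable are rank one, with the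
    constant \<open>g 0\<close> absorbed into the function of \<open>u\<close>; only Psi(t - u)
    needs the preceding analysis.\<close>
  have k_eq: "?k t u = (- 1) * Psi (t - u) + (Psi t * 1 + 1 * (Psi (- u) - Psi 0))" for t u
    by (simp add: screw_kernel_def)
  have cont: "continuous_on UNIV (\<lambda>(t, u). ?k t u)"
    unfolding k_eq split_beta
    by (intro continuous_intros continuous_on_compose2[OF continuous_on_Psi]) auto
  have "continuous_on UNIV (?k t)" for t
    unfolding k_eq by (intro continuous_intros continuous_on_compose2[OF continuous_on_Psi]) auto
  then have op_eq: "?T f t = kernel_op ?M ?k f t" if "f \<in> L2 ?M" "t \<in> {-a<..<a}" for f t
    using that by (intro screw_operator_eq_kernel_op borel_measurable_continuous_onI L2_measurable)
  have sym: "?k u t = ?k t u" for t u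
    by (simp add: screw_kernel_def Psi_def abs_minus_commute)
  obtain \<kappa> where "compact_hermitian_kernel ?M (\<lambda>t u. of_real (?k t u)) \<kappa> ?T"
    by (rule compact_hermitian_kernel_leb_on[OF cont sym op_eq])
  then interpret compact_hermitian_kernel ?M "\<lambda>t u. of_real (?k t u)" \<kappa> ?T .
  obtain C1 where 1: "nuclear_kernel ?M C1 (\<lambda>t u. Psi (t - u))"
    by (rule nuclear_kernel_Psi[OF assms])
  obtain C2 where 2: "nuclear_kernel ?M C2 (\<lambda>t u. Psi t * 1)"
    by (rule nuclear_kernel_continuous_product[of Psi "\<lambda>_. 1"])
       (auto intro!: continuous_intros continuous_on_Psi)
  obtain C3 where 3: "nuclear_kernel ?M C3 (\<lambda>t u. 1 * (Psi (- u) - Psi 0))"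
    by (rule nuclear_kernel_continuous_product[of "\<lambda>_. 1" "\<lambda>u. Psi (- u) - Psi 0"])
       (auto intro!: continuous_intros continuous_on_compose2[OF continuous_on_Psi])
  obtain C where C: "nuclear_kernel ?M C ?k"
    using nuclear_kernel_cong[OF nuclear_kernel_add[OF nuclear_kernel_scale[OF 1, of "- 1"] nuclear_kernel_add[OF 2 3]], of ?k]
      k_eq by metis
  show ?thesis
  proof (rule trace_class_if_eigenvalue_sums_bounded)
    fix F assume F: "finite F" "L2_orthonormal ?M F"
    have "L2_inner ?M (?T e) e = L2_inner ?M (kernel_op ?M ?k e) e" if "e \<in> F" for e
    proof -
      have "e \<in> L2 ?M" using F that by (auto simp: L2_orthonormal_def)
      then show ?thesis
        unfolding L2_inner_def
        by (intro Bochner_Integration.integral_cong refl) (simp add: op_eq space_restrict_space)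
    qed
    then show "(\<Sum>e\<in>F. cmod (L2_inner ?M (?T e) e)) \<le> C"
      using nuclear_kernelD(2)[OF C F] by simp
  qed
qed

end
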